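(* Let $H$ be a Hilbert space with inner product $\langle\cdot,\cdot\rangle$, let $A$ generate a $C_0$-semigroup of contractions $S(t)$ on $H$, and let $B$ be a bounded linear operator on $H$ such that $B^*=B\ge0$ and, for some $\beta>0$, $B\ge\beta I$ on $\ker(B)^\perp$ (i.e. $\langle Bx,x\rangle\ge\beta\|x\|^2$ for all $x\in\ker(B)^\perp$). Assume that $\ker(B)^\perp$ is invariant under the semigroup $S(t)$. Let $0<\mu<1/2$ and consider the bilinear system $$\dot x(t)=Ax(t)+u(t)Bx(t),\qquad x(0)=x_0,$$ with scalar control $u(t)\in\mathbb{R}$. Then the system is finite-time stable on $\ker(B)^\perp$, with the stabilizing feedback control $$u(x)=-\langle Bx,x\rangle^{-\mu}\ \text{ if } x\ne0,\qquad u(x)=0\ \text{ if } x=0.$$ Furthermore, if $\ker(B)^\perp$ is absorbent, in a finite time $\tau>0$, for the semigroup $S(t)$, then the system is globally finite-time stable (i.e. for all $x_0\in H$) under the control $$u=\begin{cases}0, & 0\le t\le\tau,\\ -\langle Bx,x\rangle^{-\mu}\,\mathbf{1}_{(x\ne0)}, & t>\tau.\end{cases}$$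
   Context: Invariance means $S(t)\ker(B)^\perp\subset\ker(B)^\perp$ for all $t\ge0$. The subspace $\ker(B)^\perp$ is absorbent in time $\tau$ for $S(t)$ if $S(\tau)x_0\in\ker(B)^\perp$ for all $x_0\in H$. Finite-time stability on a closed subspace $F\subset H$ (with $F=\ker(B)^\perp$, on which the closed-loop system induces a subsystem with state space $F$) under a given feedback means: for every $x_0\in F$ the closed-loop system admits a unique $F$-valued solution $x$ on $[0,+\infty)$ (in the mild sense: $x$ continuous and $x(t)=S(t)x_0+\int_0^tS(t-s)u(s)Bx(s)\,ds$, with $u$ the feedback evaluated along $x$ and the integrand read as $0$ when $x(s)=0$), $0$ is Lyapunov stable (for every $\varepsilon>0$ there is $\alpha>0$ such that every trajectory starting in the $\alpha$-ball remains in the $\varepsilon$-ball for all $t\ge0$), and for every $x_0$ there is $T=T(x_0)>0$ with $x(t)=0$ for all $t\ge T$. For the global statement the same properties are required for all $x_0\in H$, the solution being $S(t)x_0$ on $[0,\tau]$ and, for $t>\tau$, the solution in $\ker(B)^\perp$ starting from $S(\tau)x_0$ at time $\tau$. *)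

theory Defs
  imports "HOL-Analysis.Analysis"
begin

definition C0_semigroup :: "(real \<Rightarrow> 'a::real_normed_vector \<Rightarrow> 'a) \<Rightarrow> bool" where
  "C0_semigroup S \<longleftrightarrow>
     (\<forall>t\<ge>0. bounded_linear (S t)) \<and>
     (\<forall>x. S 0 x = x) \<and>
     (\<forall>s\<ge>0. \<forall>t\<ge>0. \<forall>x. S (s + t) x = S s (S t x)) \<and>
     (\<forall>x. ((\<lambda>t. S t x) \<longlongrightarrow> x) (at_right 0))"

definition contraction_semigroup :: "(real \<Rightarrow> 'a::real_normed_vector \<Rightarrow> 'a) \<Rightarrow> bool" where
  "contraction_semigroup S \<longleftrightarrow> C0_semigroup S \<and> (\<forall>t\<ge>0. \<forall>x. norm (S t x) \<le> norm x)"

text \<open>An unbounded operator is a domain \<open>D\<close> together with a function \<open>A\<close>, whose values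
  outside \<open>D\<close> are irrelevant.\<close>

definition generates ::
    "'a set \<Rightarrow> ('a \<Rightarrow> 'a) \<Rightarrow> (real \<Rightarrow> 'a::real_normed_vector \<Rightarrow> 'a) \<Rightarrow> bool" where
  "generates D A S \<longleftrightarrow>
     D = {x. \<exists>y. ((\<lambda>t. (S t x - x) /\<^sub>R t) \<longlongrightarrow> y) (at_right 0)} \<and>
     (\<forall>x\<in>D. ((\<lambda>t. (S t x - x) /\<^sub>R t) \<longlongrightarrow> A x) (at_right 0))"

text \<open>\<open>B\<^sup>* = B\<close> for a bounded operator, \<open>B\<^sup>*\<close> being characterised by
  \<open>\<langle>B x, y\<rangle> = \<langle>x, B\<^sup>* y\<rangle>\<close>.\<close>

definition self_adjoint :: "('a::real_inner \<Rightarrow> 'a) \<Rightarrow> bool" where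
  "self_adjoint B \<longleftrightarrow> (\<forall>x y. B x \<bullet> y = x \<bullet> B y)"

abbreviation ker_perp :: "('a::real_inner \<Rightarrow> 'a) \<Rightarrow> 'a set" where
  "ker_perp B \<equiv> {x. B x = 0}\<^sup>\<bottom>"

definition invariant_under :: "(real \<Rightarrow> 'a \<Rightarrow> 'a) \<Rightarrow> 'a set \<Rightarrow> bool" where
  "invariant_under S F \<longleftrightarrow> (\<forall>t\<ge>0. S t ` F \<subseteq> F)"

definition absorbent_in_time :: "real \<Rightarrow> (real \<Rightarrow> 'a \<Rightarrow> 'a) \<Rightarrow> 'a set \<Rightarrow> bool" where
  "absorbent_in_time \<tau> S F \<longleftrightarrow> (\<forall>x. S \<tau> x \<in> F)"

definition feedback :: "('a::real_inner \<Rightarrow> 'a) \<Rightarrow> real \<Rightarrow> 'a \<Rightarrow> real" where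
  "feedback B \<mu> x = (if x \<noteq> 0 then - ((B x \<bullet> x) powr (- \<mu>)) else 0)"

definition switched_feedback :: "('a::real_inner \<Rightarrow> 'a) \<Rightarrow> real \<Rightarrow> real \<Rightarrow> real \<Rightarrow> 'a \<Rightarrow> real" where
  "switched_feedback B \<mu> \<tau> t x = (if t \<le> \<tau> then 0 else feedback B \<mu> x)"

text \<open>Mild solution, on \<open>[t0, \<infinity>)\<close>, of \<open>x' = A x + u(t, x) B x\<close>, \<open>x(t0) = x0\<close>.
  Stating the Duhamel formula with \<open>has_integral\<close> makes integrability of the integrand part
  of the definition. Values of \<open>x\<close> before \<open>t0\<close> are irrelevant.\<close>

definition mild_solution ::
    "(real \<Rightarrow> 'a::real_normed_vector \<Rightarrow> 'a) \<Rightarrow> ('a \<Rightarrow> 'a) \<Rightarrow> (real \<Rightarrow> 'a \<Rightarrow> real) \<Rightarrow>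
      real \<Rightarrow> 'a \<Rightarrow> (real \<Rightarrow> 'a) \<Rightarrow> bool" where
  "mild_solution S B u t0 x0 x \<longleftrightarrow>
     continuous_on {t0..} x \<and>
     (\<forall>t\<ge>t0. ((\<lambda>s. S (t - s) (u s (x s) *\<^sub>R B (x s)))
        has_integral (x t - S (t - t0) x0)) {t0..t})"

definition subspace_trajectory ::
    "(real \<Rightarrow> 'a::real_normed_vector \<Rightarrow> 'a) \<Rightarrow> ('a \<Rightarrow> 'a) \<Rightarrow> (real \<Rightarrow> 'a \<Rightarrow> real) \<Rightarrow>
      'a set \<Rightarrow> real \<Rightarrow> 'a \<Rightarrow> (real \<Rightarrow> 'a) \<Rightarrow> bool" where
  "subspace_trajectory S B u F t0 x0 x \<longleftrightarrow>
     (\<forall>t\<ge>t0. x t \<in> F) \<and> mild_solution S B u t0 x0 x"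

definition global_trajectory ::
    "(real \<Rightarrow> 'a::real_normed_vector \<Rightarrow> 'a) \<Rightarrow> ('a \<Rightarrow> 'a) \<Rightarrow> (real \<Rightarrow> 'a \<Rightarrow> real) \<Rightarrow>
      'a set \<Rightarrow> real \<Rightarrow> 'a \<Rightarrow> (real \<Rightarrow> 'a) \<Rightarrow> bool" where
  "global_trajectory S B u F \<tau> x0 x \<longleftrightarrow>
     (\<forall>t\<in>{0..\<tau>}. x t = S t x0) \<and> subspace_trajectory S B u F \<tau> (S \<tau> x0) x"

text \<open>\<open>traj x0 x\<close> says that \<open>x\<close>, restricted to \<open>[0, \<infinity>)\<close>, is a trajectory starting from \<open>x0\<close>;
  \<open>F\<close> is the set of admissible initial states.\<close>

definition finite_time_stable_on ::
    "'a::real_normed_vector set \<Rightarrow> ('a \<Rightarrow> (real \<Rightarrow> 'a) \<Rightarrow> bool) \<Rightarrow> bool" where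
  "finite_time_stable_on F traj \<longleftrightarrow>
     (\<forall>x0\<in>F. \<exists>x. traj x0 x \<and> (\<forall>y. traj x0 y \<longrightarrow> (\<forall>t\<ge>0. y t = x t))) \<and>
     (\<forall>\<epsilon>>0. \<exists>\<alpha>>0. \<forall>x0\<in>F. \<forall>x. norm x0 < \<alpha> \<and> traj x0 x \<longrightarrow> (\<forall>t\<ge>0. norm (x t) < \<epsilon>)) \<and>
     (\<forall>x0\<in>F. \<exists>T>0. \<forall>x. traj x0 x \<longrightarrow> (\<forall>t\<ge>T. x t = 0))"

text \<open>Consistency check for \<open>global_trajectory\<close>: under a control that vanishes on \<open>[0, \<tau>]\<close>, the
  two pieces together satisfy the Duhamel formula on all of \<open>[0, \<infinity>)\<close>, and conversely.\<close>

lemma global_trajectory_iff_duhamel: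
  fixes S :: "real \<Rightarrow> 'a::banach \<Rightarrow> 'a"
  assumes S: "C0_semigroup S" and \<tau>: "0 \<le> \<tau>"
    and u: "\<And>s y. s \<le> \<tau> \<Longrightarrow> u s y = 0"
  shows "global_trajectory S B u F \<tau> x0 x \<longleftrightarrow>
    continuous_on {\<tau>..} x \<and> (\<forall>t\<ge>\<tau>. x t \<in> F) \<and>
    (\<forall>t\<ge>0. ((\<lambda>s. S (t - s) (u s (x s) *\<^sub>R B (x s))) has_integral (x t - S t x0)) {0..t})"
proof -
  define f where "f t s = S (t - s) (u s (x s) *\<^sub>R B (x s))" for t s
  have zero: "(f t has_integral 0) {0..r}" if "0 \<le> r" "r \<le> \<tau>" "r \<le> t" for t r
  proof (rule has_integral_is_0)
    fix s assume "s \<in> {0..r}"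
    moreover from this that have "bounded_linear (S (t - s))"
      using S by (simp add: C0_semigroup_def)
    ultimately show "f t s = 0"
      using that u by (simp add: f_def linear_0 bounded_linear.linear)
  qed
  have early: "(f t has_integral (x t - S t x0)) {0..t} \<longleftrightarrow> x t = S t x0"
    if "0 \<le> t" "t \<le> \<tau>" for t
    by (metis zero[of t t] that has_integral_unique order_refl eq_iff_diff_eq_0)
  have late: "(f t has_integral (x t - S t x0)) {0..t} \<longleftrightarrow>
      (f t has_integral (x t - S (t - \<tau>) (S \<tau> x0))) {\<tau>..t}" if t: "\<tau> \<le> t" for t
  proof -
    have split: "S (t - \<tau>) (S \<tau> x0) = S t x0"
    proof -
      have "\<And>a b y. 0 \<le> a \<Longrightarrow> 0 \<le> b \<Longrightarrow> S (a + b) y = S a (S b y)"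
        using S by (simp add: C0_semigroup_def)
      from this[of "t - \<tau>" \<tau> x0] t \<tau> have "S ((t - \<tau>) + \<tau>) x0 = S (t - \<tau>) (S \<tau> x0)"
        by argo
      then show ?thesis by simp
    qed
    have z: "(f t has_integral 0) {0..\<tau>}" using zero \<tau> t by blast
    show ?thesis
    proof
      assume l: "(f t has_integral (x t - S t x0)) {0..t}"
      then have "f t integrable_on {0..t}" by blast
      then have "f t integrable_on {\<tau>..t}"
        by (rule integrable_on_subinterval) (use \<tau> in auto)
      then obtain i where i: "(f t has_integral i) {\<tau>..t}" by blast
      have "(f t has_integral i) {0..t}"
        using has_integral_combine[OF \<tau> t z i] by simp
      with l have "i = x t - S t x0" using has_integral_unique by blast
      with i split show "(f t has_integral (x t - S (t - \<tau>) (S \<tau> x0))) {\<tau>..t}" by simp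
    next
      assume "(f t has_integral (x t - S (t - \<tau>) (S \<tau> x0))) {\<tau>..t}"
      from has_integral_combine[OF \<tau> t z this] split
      show "(f t has_integral (x t - S t x0)) {0..t}" by simp
    qed
  qed
  have "(\<forall>t\<ge>0. (f t has_integral (x t - S t x0)) {0..t}) \<longleftrightarrow>
      (\<forall>t\<in>{0..\<tau>}. x t = S t x0) \<and>
      (\<forall>t\<ge>\<tau>. (f t has_integral (x t - S (t - \<tau>) (S \<tau> x0))) {\<tau>..t})"
    (is "?l \<longleftrightarrow> ?r1 \<and> ?r2")
  proof (intro iffI conjI allI impI ballI)
    fix t assume ?l "t \<in> {0..\<tau>}"
    then show "x t = S t x0" using early[of t] by simp
  next
    fix t assume ?l "\<tau> \<le> t"
    then show "(f t has_integral (x t - S (t - \<tau>) (S \<tau> x0))) {\<tau>..t}"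
      using late[of t] \<tau> by simp
  next
    fix t :: real assume r: "?r1 \<and> ?r2" and t: "0 \<le> t"
    show "(f t has_integral (x t - S t x0)) {0..t}"
    proof (cases "t \<le> \<tau>")
      case True
      then show ?thesis using early[of t] r t by simp
    next
      case False
      then show ?thesis using late[of t] r by simp
    qed
  qed
  then show ?thesis
    unfolding global_trajectory_def subspace_trajectory_def mild_solution_def f_def by blast
qed

end

theory Submission
  imports Defs
begin

text \<open>
  The closed-loop nonlinearity \<open>f x = - (B x \<bullet> x) powr (- \<mu>) *\<^sub>R B x\<close> is, up to a positive factor,
  minus the gradient of \<open>(B x \<bullet> x) powr (1 - \<mu>)\<close>. This potential is the power \<open>2 - 2 * \<mu>\<close> of a
  seminorm, hence convex, as \<open>2 - 2 * \<mu> > 1\<close>. So \<open>f\<close> is dissipative, that is,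
  \<open>(f x - f y) \<bullet> (x - y) \<le> 0\<close>; the proof (\<open>dissipative_damping\<close>) replaces convexity by Cauchy-Schwarz
  for \<open>B x \<bullet> y\<close> and the monotonicity of \<open>s powr (1 - 2 * \<mu>)\<close>. Dissipativity of \<open>f\<close> together with
  contractivity of the semigroup gives well-posedness and stability.

  The link is an energy inequality. Mild solutions need not be differentiable, but the Duhamel
  formula gives \<open>x (t + h) = S h (x t) + h w(t) + o(h)\<close> with forcing term \<open>w\<close>, and contractivity
  then bounds the upper right Dini derivative of \<open>\<parallel>x\<parallel>\<^sup>2\<close> by \<open>2 * (w \<bullet> x)\<close> (\<open>energy_increment\<close>,
  \<open>energy_bound\<close>). Applied to the difference of two solutions it yields uniqueness; applied to a
  solution and \<open>f 0 = 0\<close> it yields that the norm never increases, hence Lyapunov stability.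

  Existence: \<open>f\<close> is not Lipschitz near the kernel of \<open>B\<close>. Replacing \<open>B x \<bullet> x\<close> by
  \<open>max (B x \<bullet> x) \<epsilon>\<close> in the gain keeps dissipativity, makes the nonlinearity Lipschitz, and changes it by
  at most a multiple of \<open>\<epsilon> powr (1 / 2 - \<mu>)\<close>, uniformly on the whole space. The regularised
  equations are solved by Picard iteration, and dissipativity makes their solutions converge
  locally uniformly as \<open>\<epsilon>\<close> tends to 0 (\<open>dissipative_limit_orbit_exists\<close>). Since \<open>B\<close> is
  self-adjoint, its values are orthogonal to its kernel, so the Duhamel formula keeps the solution in
  the invariant subspace.

  Extinction: on that subspace coercivity turns the energy inequality for \<open>E = \<parallel>x\<parallel>\<^sup>2\<close> into
  \<open>E' \<le> - 2 * c * E powr (1 - \<mu>)\<close>. Thus \<open>E powr \<mu>\<close> decreases at least at the constant rate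
  \<open>2 * c * \<mu>\<close> while it is positive, and must vanish in finite time (\<open>finite_time_extinction\<close>); afterwards the
  nonincreasing norm stays 0. If the subspace absorbs every orbit by time \<open>\<tau>\<close>, the
  switched control leads to the same closed loop, shifted by \<open>\<tau>\<close>
  (\<open>switched_finite_time_stable\<close>).
\<close>

section \<open>Contraction semigroups and the Duhamel formula\<close>

lemma contraction_semigroupD:
  assumes "contraction_semigroup S"
  shows "0 \<le> t \<Longrightarrow> bounded_linear (S t)"
    and "S 0 x = x"
    and "0 \<le> s \<Longrightarrow> 0 \<le> t \<Longrightarrow> S (s + t) x = S s (S t x)"
    and "((\<lambda>t. S t x) \<longlongrightarrow> x) (at_right 0)"
    and "0 \<le> t \<Longrightarrow> norm (S t x) \<le> norm x"
  using assms unfolding contraction_semigroup_def C0_semigroup_def by blast+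

lemma contraction_semigroup_diff:
  assumes "contraction_semigroup S" and "0 \<le> t"
  shows "S t (x - y) = S t x - S t y"
  using contraction_semigroupD(1)[OF assms] by (simp add: bounded_linear.linear linear_diff)

lemma contraction_semigroup_near_0:
  assumes "contraction_semigroup S" and "0 < e"
  obtains d where "0 < d" "\<And>h. 0 \<le> h \<Longrightarrow> h < d \<Longrightarrow> norm (S h x - x) < e"
proof -
  have "\<forall>\<^sub>F h in at_right 0. dist (S h x) x < e"
    using tendstoD[OF contraction_semigroupD(4)[OF assms(1)] assms(2)] .
  then obtain d where d: "0 < d" "\<And>h. 0 < h \<Longrightarrow> h < d \<Longrightarrow> dist (S h x) x < e"
    unfolding eventually_at_right_field by auto
  have "norm (S h x - x) < e" if "0 \<le> h" "h < d" for h
    using that d(2)[of h] assms contraction_semigroupD(2)[OF assms(1)]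
    by (cases "h = 0") (auto simp: dist_norm)
  with d(1) show ?thesis by (rule that)
qed

lemma contraction_semigroup_dist:
  assumes "contraction_semigroup S" and "0 \<le> s" "0 \<le> t"
  shows "norm (S t x - S s x) \<le> norm (S \<bar>t - s\<bar> x - x)"
proof -
  have *: "norm (S t x - S s x) \<le> norm (S (t - s) x - x)" if "0 \<le> s" "s \<le> t" for s t
  proof -
    have "S t x - S s x = S s (S (t - s) x - x)"
      using contraction_semigroupD(3)[OF assms(1), of s "t - s" x] that
      by (simp add: contraction_semigroup_diff[OF assms(1)])
    then show ?thesis using contraction_semigroupD(5)[OF assms(1) that(1)] by simp
  qed
  show ?thesis
  proof (cases "s \<le> t")
    case True
    then show ?thesis using *[of s t] assms by simp
  next
    case False
    then show ?thesis using *[of t s] assms by (simp add: norm_minus_commute)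
  qed
qed

text \<open>Contractivity makes the orbit maps equicontinuous in the state, so strong continuity in
  time upgrades to joint continuity.\<close>

lemma continuous_on_semigroup:
  fixes S :: "real \<Rightarrow> 'a::real_normed_vector \<Rightarrow> 'a" and T :: "'b::topological_space set"
  assumes S: "contraction_semigroup S"
    and a: "continuous_on T a" and v: "continuous_on T v" and pos: "\<And>x. x \<in> T \<Longrightarrow> 0 \<le> a x"
  shows "continuous_on T (\<lambda>x. S (a x) (v x))"
  unfolding continuous_on_def
proof (intro ballI tendstoI)
  fix x and e :: real assume x: "x \<in> T" and e: "0 < e"
  obtain d where d: "0 < d" "\<And>h. 0 \<le> h \<Longrightarrow> h < d \<Longrightarrow> norm (S h (v x) - v x) < e / 2"
    using contraction_semigroup_near_0[OF S, of "e / 2" "v x"] e by auto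
  have "\<forall>\<^sub>F y in at x within T. dist (a y) (a x) < d"
    using a x d(1) by (auto simp: continuous_on_def intro: tendstoD)
  moreover have "\<forall>\<^sub>F y in at x within T. dist (v y) (v x) < e / 2"
    using v x e by (intro tendstoD[of v "v x"]) (simp_all add: continuous_on_def)
  moreover have "\<forall>\<^sub>F y in at x within T. y \<in> T"
    by (simp add: eventually_at_filter)
  ultimately show "\<forall>\<^sub>F y in at x within T. dist (S (a y) (v y)) (S (a x) (v x)) < e"
  proof eventually_elim
    case (elim y)
    have "norm (S (a y) (v y) - S (a y) (v x)) < e / 2"
      using contraction_semigroupD(5)[OF S, of "a y" "v y - v x"] elim pos
      by (simp add: contraction_semigroup_diff[OF S] dist_norm)
    moreover have "norm (S (a y) (v x) - S (a x) (v x)) < e / 2"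
      using contraction_semigroup_dist[OF S, of "a x" "a y" "v x"] d(2)[of "\<bar>a y - a x\<bar>"] elim x pos
      by (auto simp: dist_real_def)
    ultimately show ?case
      using norm_diff_triangle_less[of "S (a y) (v y)" "S (a y) (v x)" "e/2" "S (a x) (v x)" "e/2"]
      by (simp add: dist_norm)
  qed
qed

text \<open>The mild solution of \<open>x' = A x + w\<close> with \<open>x 0 = x0\<close>. Keeping the forcing term as a function
  of time, detached from the feedback, allows differences of solutions of nonlinear equations to be
  treated as solutions of one linear equation.\<close>

definition forced_orbit ::
    "(real \<Rightarrow> 'a::real_normed_vector \<Rightarrow> 'a) \<Rightarrow> (real \<Rightarrow> 'a) \<Rightarrow> 'a \<Rightarrow> (real \<Rightarrow> 'a) \<Rightarrow> bool" where
  "forced_orbit S w x0 x \<longleftrightarrow> continuous_on {0..} x \<and>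
     (\<forall>t\<ge>0. ((\<lambda>s. S (t - s) (w s)) has_integral (x t - S t x0)) {0..t})"

lemma forced_orbit_0:
  assumes "contraction_semigroup S" "forced_orbit S w x0 x"
  shows "x 0 = x0"
proof -
  have "((\<lambda>s. S (0 - s) (w s)) has_integral (x 0 - S 0 x0)) {0..0}"
    using assms(2) unfolding forced_orbit_def by blast
  moreover have "((\<lambda>s. S (0 - s) (w s)) has_integral 0) {0..(0::real)}"
    using has_integral_refl(2)[of "\<lambda>s. S (0 - s) (w s)" "0::real"] by simp
  ultimately have "x 0 - S 0 x0 = 0" using has_integral_unique by blast
  then show ?thesis using contraction_semigroupD(2)[OF assms(1)] by simp
qed

lemma forced_orbit_diff:
  assumes S: "contraction_semigroup S"
    and "forced_orbit S v x0 x" "forced_orbit S w y0 y"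
  shows "forced_orbit S (\<lambda>t. v t - w t) (x0 - y0) (\<lambda>t. x t - y t)"
  unfolding forced_orbit_def
proof (intro conjI allI impI)
  show "continuous_on {0..} (\<lambda>t. x t - y t)"
    using assms(2,3) unfolding forced_orbit_def by (auto intro: continuous_intros)
  fix t :: real assume t: "0 \<le> t"
  have "((\<lambda>s. S (t - s) (v s) - S (t - s) (w s)) has_integral (x t - S t x0) - (y t - S t y0)) {0..t}"
    using assms(2,3) t unfolding forced_orbit_def by (intro has_integral_diff) blast+
  then show "((\<lambda>s. S (t - s) (v s - w s)) has_integral x t - y t - S t (x0 - y0)) {0..t}"
    by (rule has_integral_eq_rhs[OF has_integral_eq, rotated])
      (use t in \<open>auto simp: contraction_semigroup_diff[OF S]\<close>)
qed

text \<open>Both the kernel and the endpoint depend on \<open>t\<close>. Rescaling to the unit interval leaves only a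
  parameter-dependent integrand, which is jointly continuous.\<close>

lemma continuous_on_convolution:
  fixes S :: "real \<Rightarrow> 'a::banach \<Rightarrow> 'a"
  assumes S: "contraction_semigroup S" and w: "continuous_on {0..} w"
  shows "continuous_on {0..} (\<lambda>t. integral {0..t} (\<lambda>s. S (t - s) (w s)))"
proof -
  have "continuous_on ({0..} \<times> cbox 0 1) (\<lambda>(t, r). S (t * (1 - r)) (w (t * r)))"
    unfolding split_beta
    by (intro continuous_on_semigroup[OF S] continuous_on_compose2[OF w] continuous_intros) auto
  then have c: "continuous_on {0..} (\<lambda>t. integral (cbox 0 1) (\<lambda>r. S (t * (1 - r)) (w (t * r))))"
    by (rule integral_continuous_on_param)
  have sc: "continuous_on {0..} (\<lambda>t. t *\<^sub>R integral {0..1} (\<lambda>r. S (t * (1 - r)) (w (t * r))))"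
    using c by (auto intro: continuous_intros)
  have "integral {0..t} (\<lambda>s. S (t - s) (w s)) =
      t *\<^sub>R integral {0..1} (\<lambda>r. S (t * (1 - r)) (w (t * r)))" if t: "0 \<le> t" for t
  proof (cases "t = 0")
    case False
    then have t: "0 < t" using t by simp
    have "continuous_on {0..t} (\<lambda>s. S (t - s) (w s))"
      by (intro continuous_on_semigroup[OF S] continuous_on_subset[OF w] continuous_intros) auto
    then have "(\<lambda>s. S (t - s) (w s)) integrable_on {0..t}"
      by (rule integrable_continuous_interval)
    from has_integral_affinity'[OF integrable_integral[OF this, folded cbox_interval] t, of 0]
    have "((\<lambda>r. S (t - t * r) (w (t * r))) has_integral
        integral {0..t} (\<lambda>s. S (t - s) (w s)) /\<^sub>R t) {0..1}"
      using t by simp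
    then have "integral {0..1} (\<lambda>r. S (t * (1 - r)) (w (t * r))) =
        integral {0..t} (\<lambda>s. S (t - s) (w s)) /\<^sub>R t"
      by (simp add: integral_unique right_diff_distrib)
    then show ?thesis using t by simp
  qed simp
  then show ?thesis
    by (intro continuous_on_eq[OF sc]) simp
qed

lemma forced_orbit_convolution:
  fixes S :: "real \<Rightarrow> 'a::banach \<Rightarrow> 'a"
  assumes S: "contraction_semigroup S" and w: "continuous_on {0..} w"
  shows "forced_orbit S w x0 (\<lambda>t. S t x0 + integral {0..t} (\<lambda>s. S (t - s) (w s)))"
  unfolding forced_orbit_def
proof (intro conjI allI impI)
  show "continuous_on {0..} (\<lambda>t. S t x0 + integral {0..t} (\<lambda>s. S (t - s) (w s)))"
    by (intro continuous_intros continuous_on_semigroup[OF S] continuous_on_convolution[OF S w]) auto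
  fix t :: real assume t: "0 \<le> t"
  have "continuous_on {0..t} (\<lambda>s. S (t - s) (w s))"
    by (intro continuous_on_semigroup[OF S] continuous_on_subset[OF w] continuous_intros) auto
  then show "((\<lambda>s. S (t - s) (w s)) has_integral
      S t x0 + integral {0..t} (\<lambda>s. S (t - s) (w s)) - S t x0) {0..t}"
    by (simp add: integrable_integral integrable_continuous_interval)
qed

text \<open>The semigroup law lets the orbit be restarted at any time \<open>t\<close> from its current state.\<close>

lemma forced_orbit_restart:
  fixes S :: "real \<Rightarrow> 'a::banach \<Rightarrow> 'a"
  assumes S: "contraction_semigroup S" and x: "forced_orbit S w x0 x" and t: "0 \<le> t" "0 \<le> h"
  shows "((\<lambda>s. S (t + h - s) (w s)) has_integral (x (t + h) - S h (x t))) {t..t + h}"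
proof -
  have "((\<lambda>s. S (t - s) (w s)) has_integral (x t - S t x0)) {0..t}"
    using x t unfolding forced_orbit_def by blast
  from has_integral_linear[OF this contraction_semigroupD(1)[OF S t(2)]]
  have S1: "((\<lambda>s. S h (S (t - s) (w s))) has_integral S h (x t - S t x0)) {0..t}"
    by (simp add: o_def)
  have "S h (S (t - s) (w s)) = S (t + h - s) (w s)" if "s \<in> {0..t}" for s
    using contraction_semigroupD(3)[OF S t(2), of "t - s" "w s"] that by (simp add: algebra_simps)
  from has_integral_eq[OF this S1]
  have "((\<lambda>s. S (t + h - s) (w s)) has_integral S h (x t - S t x0)) {0..t}" .
  moreover have "S h (x t - S t x0) = S h (x t) - S (t + h) x0"
    using contraction_semigroupD(3)[OF S t(2,1)] t(2)
    by (simp add: contraction_semigroup_diff[OF S] add.commute)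
  ultimately have 1: "((\<lambda>s. S (t + h - s) (w s)) has_integral (S h (x t) - S (t + h) x0)) {0..t}"
    by simp
  have 2: "((\<lambda>s. S (t + h - s) (w s)) has_integral (x (t + h) - S (t + h) x0)) {0..t + h}"
    using x t unfolding forced_orbit_def by simp
  have "(\<lambda>s. S (t + h - s) (w s)) integrable_on {t..t + h}"
    using integrable_on_subinterval[of _ "{0..t + h}" t "t + h"] 2 t by auto
  then obtain i where i: "((\<lambda>s. S (t + h - s) (w s)) has_integral i) {t..t + h}" by blast
  have "((\<lambda>s. S (t + h - s) (w s)) has_integral (S h (x t) - S (t + h) x0) + i) {0..t + h}"
    by (rule has_integral_combine[OF _ _ 1 i]) (use t in auto)
  then have "x (t + h) - S (t + h) x0 = (S h (x t) - S (t + h) x0) + i"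
    using 2 has_integral_unique by blast
  then have "i = x (t + h) - S h (x t)" by (simp add: algebra_simps)
  with i show ?thesis by simp
qed

section \<open>Energy inequalities for mild solutions\<close>

text \<open>A comparison principle for the upper right Dini derivative. With a slack \<open>\<eta>\<close> in the slope, the
  last time at which the bound holds cannot lie before \<open>b\<close>, since the Dini bound extends it to the
  right; then \<open>\<eta>\<close> tends to 0.\<close>

lemma right_Dini_bound:
  fixes \<phi> :: "real \<Rightarrow> real"
  assumes ab: "a \<le> b" and cont: "continuous_on {a..b} \<phi>"
    and Dini: "\<And>t \<eta>. a \<le> t \<Longrightarrow> t < b \<Longrightarrow> 0 < \<eta> \<Longrightarrow>
      \<forall>\<^sub>F h in at_right 0. \<phi> (t + h) \<le> \<phi> t + h * (k + \<eta>)"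
  shows "\<phi> b \<le> \<phi> a + k * (b - a)"
proof -
  have eta: "\<phi> b \<le> \<phi> a + (k + \<eta>) * (b - a)" if \<eta>: "0 < \<eta>" for \<eta>
  proof -
    define P where "P = {t \<in> {a..b}. \<phi> t \<le> \<phi> a + (k + \<eta>) * (t - a)}"
    have "closed P"
      unfolding P_def by (intro continuous_on_closed_Collect_le cont continuous_intros)
    moreover have "a \<in> P" using ab by (simp add: P_def)
    moreover have bdd: "bdd_above P" by (rule bdd_aboveI[of _ b]) (simp add: P_def)
    ultimately have c: "Sup P \<in> P" using closed_contains_Sup by blast
    define c where "c = Sup P"
    have "c = b"
    proof (rule ccontr)
      assume "c \<noteq> b"
      then have c': "a \<le> c" "c < b" "\<phi> c \<le> \<phi> a + (k + \<eta>) * (c - a)"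
        using c by (auto simp: P_def c_def)
      have "\<forall>\<^sub>F h in at_right 0. h < b - c"
        unfolding eventually_at_right_field using c'(2) by (intro exI[of _ "b - c"]) auto
      with Dini[OF c'(1,2) \<eta>] eventually_at_right_less[of "0::real"]
      have "\<forall>\<^sub>F h in at_right (0::real). False"
      proof eventually_elim
        case (elim h)
        have "\<phi> (c + h) \<le> \<phi> a + (k + \<eta>) * (c + h - a)"
          using elim c'(3) by (simp add: algebra_simps)
        then have "c + h \<in> P" using elim c' by (simp add: P_def)
        then have "c + h \<le> c" unfolding c_def using cSup_upper bdd by blast
        then show False using elim by simp
      qed
      then show False by simp
    qed
    then show ?thesis using c by (simp add: P_def c_def)
  qed
  show ?thesis
  proof (rule field_le_epsilon)
    fix e :: real assume e: "0 < e"
    define d where "d = e / (b - a + 1)"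
    have "0 < d" using e ab by (simp add: d_def)
    have "d * (b - a) \<le> d * (b - a + 1)" using \<open>0 < d\<close> by (intro mult_left_mono) auto
    also have "\<dots> = e" using ab by (simp add: d_def)
    finally show "\<phi> b \<le> \<phi> a + k * (b - a) + e"
      using eta[OF \<open>0 < d\<close>] by (simp add: algebra_simps)
  qed
qed

text \<open>The first-order expansion of a mild solution, with the semigroup part kept exact because
  \<open>S h (x t) - x t\<close> need not be of order \<open>h\<close>.\<close>

lemma forced_orbit_increment:
  fixes S :: "real \<Rightarrow> 'a::banach \<Rightarrow> 'a"
  assumes S: "contraction_semigroup S" and x: "forced_orbit S w x0 x"
    and w: "continuous_on {0..} w" and t: "0 \<le> t" and e: "0 < e"
  shows "\<forall>\<^sub>F h in at_right 0. norm (x (t + h) - S h (x t) - h *\<^sub>R w t) \<le> h * e"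
proof -
  obtain d1 where d1: "0 < d1" "\<And>h. 0 \<le> h \<Longrightarrow> h < d1 \<Longrightarrow> norm (S h (w t) - w t) < e / 2"
    using contraction_semigroup_near_0[OF S, of "e / 2" "w t"] e by auto
  obtain d2 where d2: "0 < d2" "\<And>s. s \<in> {0..} \<Longrightarrow> dist s t < d2 \<Longrightarrow> dist (w s) (w t) < e / 2"
    using w[unfolded continuous_on_iff, rule_format, of t "e / 2"] t e by auto
  have "norm (x (t + h) - S h (x t) - h *\<^sub>R w t) \<le> h * e" if h: "0 < h" "h < min d1 d2" for h
  proof -
    have "((\<lambda>s. S (t + h - s) (w s)) has_integral (x (t + h) - S h (x t))) {t..t + h}"
      using forced_orbit_restart[OF S x t] h by simp
    moreover have "((\<lambda>s. w t) has_integral h *\<^sub>R w t) {t..t + h}"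
      using has_integral_const_real[of "w t" t "t + h"] h by simp
    ultimately have i: "((\<lambda>s. S (t + h - s) (w s) - w t) has_integral
        (x (t + h) - S h (x t) - h *\<^sub>R w t)) {t..t + h}"
      by (rule has_integral_diff)
    have "norm (S (t + h - s) (w s) - w t) \<le> e" if s: "s \<in> {t..t + h} - {}" for s
    proof -
      have "norm (S (t + h - s) (w s) - S (t + h - s) (w t)) \<le> norm (w s - w t)"
        using contraction_semigroupD(5)[OF S, of "t + h - s" "w s - w t"] s
        by (simp add: contraction_semigroup_diff[OF S])
      also have "\<dots> < e / 2" using d2(2)[of s] s t h by (simp add: dist_norm)
      finally have "norm (S (t + h - s) (w s) - S (t + h - s) (w t)) < e / 2" .
      moreover have "norm (S (t + h - s) (w t) - w t) < e / 2" using d1(2) s h by simp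
      ultimately show ?thesis
        using norm_diff_triangle_less[of "S (t + h - s) (w s)" "S (t + h - s) (w t)" "e / 2" "w t" "e / 2"]
        by simp
    qed
    from has_integral_bound_real[OF _ finite.emptyI i this] e h show ?thesis
      by (simp add: mult.commute)
  qed
  then show ?thesis
    unfolding eventually_at_right_field using d1(1) d2(1) by (intro exI[of _ "min d1 d2"]) auto
qed

text \<open>Expanding the square of \<open>S h (x t) + h (w t + o(1))\<close>, the leading term does not exceed
  \<open>\<parallel>x t\<parallel>\<^sup>2\<close> by contractivity, and strong continuity replaces \<open>S h (x t)\<close> by \<open>x t\<close> in the cross
  term.\<close>

lemma energy_increment:
  fixes S :: "real \<Rightarrow> 'a::{real_inner, banach} \<Rightarrow> 'a"
  assumes S: "contraction_semigroup S" and x: "forced_orbit S w x0 x"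
    and w: "continuous_on {0..} w" and t: "0 \<le> t" and \<eta>: "0 < \<eta>"
  shows "\<forall>\<^sub>F h in at_right 0. (norm (x (t + h)))\<^sup>2 \<le> (norm (x t))\<^sup>2 + h * (2 * (w t \<bullet> x t) + \<eta>)"
proof -
  define r where "r h = (x (t + h) - S h (x t)) /\<^sub>R h - w t" for h
  \<comment> \<open>\<open>r\<close> is the relative error of the first-order expansion.\<close>
  have r: "(r \<longlongrightarrow> 0) (at_right 0)"
  proof (rule tendstoI)
    fix e :: real assume e: "0 < e"
    then have "\<forall>\<^sub>F h in at_right 0. norm (x (t + h) - S h (x t) - h *\<^sub>R w t) \<le> h * (e / 2)"
      by (intro forced_orbit_increment[OF S x w t]) auto
    with eventually_at_right_less[of "0::real"] show "\<forall>\<^sub>F h in at_right 0. dist (r h) 0 < e"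
    proof eventually_elim
      case (elim h)
      have "x (t + h) - S h (x t) - h *\<^sub>R w t = h *\<^sub>R r h"
        using elim by (simp add: r_def algebra_simps)
      then have "h * norm (r h) \<le> h * (e / 2)" using elim by simp
      then have "norm (r h) \<le> e / 2" using elim mult_le_cancel_left_pos by blast
      then show ?case using e by simp
    qed
  qed
  have St: "((\<lambda>h. S h (x t)) \<longlongrightarrow> x t) (at_right 0)" by (rule contraction_semigroupD(4)[OF S])
  have h0: "((\<lambda>h::real. h) \<longlongrightarrow> 0) (at_right 0)" by (rule tendsto_ident_at)
  have "((\<lambda>h. 2 * (S h (x t) \<bullet> (w t + r h)) + h * (norm (w t + r h))\<^sup>2) \<longlongrightarrow>
      2 * (x t \<bullet> (w t + 0)) + 0 * (norm (w t + 0))\<^sup>2) (at_right 0)"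
    by (intro tendsto_intros r St h0)
  then have "((\<lambda>h. 2 * (S h (x t) \<bullet> (w t + r h)) + h * (norm (w t + r h))\<^sup>2) \<longlongrightarrow>
      2 * (w t \<bullet> x t)) (at_right 0)"
    by (simp add: inner_commute)
  then have "\<forall>\<^sub>F h in at_right 0. 2 * (S h (x t) \<bullet> (w t + r h)) + h * (norm (w t + r h))\<^sup>2
      < 2 * (w t \<bullet> x t) + \<eta>"
    by (rule order_tendstoD(2)) (use \<eta> in simp)
  with eventually_at_right_less[of "0::real"] show ?thesis
  proof eventually_elim
    case (elim h)
    have xh: "x (t + h) = S h (x t) + h *\<^sub>R (w t + r h)"
      using elim by (simp add: r_def)
    have "(norm (x (t + h)))\<^sup>2 = (norm (S h (x t)))\<^sup>2
        + h * (2 * (S h (x t) \<bullet> (w t + r h)) + h * (norm (w t + r h))\<^sup>2)"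
      unfolding xh power2_norm_eq_inner
      by (simp add: inner_add_left inner_add_right inner_commute algebra_simps power2_eq_square)
    also have "\<dots> \<le> (norm (x t))\<^sup>2 + h * (2 * (w t \<bullet> x t) + \<eta>)"
      using elim contraction_semigroupD(5)[OF S, of h "x t"]
      by (intro add_mono[OF power_mono mult_left_mono[OF less_imp_le]]) auto
    finally show ?case .
  qed
qed

lemma energy_bound:
  fixes S :: "real \<Rightarrow> 'a::{real_inner, banach} \<Rightarrow> 'a"
  assumes S: "contraction_semigroup S" and x: "forced_orbit S w x0 x"
    and w: "continuous_on {0..} w" and st: "0 \<le> s" "s \<le> t"
    and k: "\<And>r. s \<le> r \<Longrightarrow> r \<le> t \<Longrightarrow> 2 * (w r \<bullet> x r) \<le> k"
  shows "(norm (x t))\<^sup>2 \<le> (norm (x s))\<^sup>2 + k * (t - s)"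
proof (rule right_Dini_bound[OF st(2), where \<phi> = "\<lambda>t. (norm (x t))\<^sup>2"])
  have "continuous_on {s..t} x"
    using x st unfolding forced_orbit_def by (auto intro: continuous_on_subset)
  then show "continuous_on {s..t} (\<lambda>t. (norm (x t))\<^sup>2)" by (intro continuous_intros)
  fix r \<eta> :: real assume r: "s \<le> r" "r < t" "0 < \<eta>"
  have "\<forall>\<^sub>F h in at_right 0. (norm (x (r + h)))\<^sup>2 \<le> (norm (x r))\<^sup>2 + h * (2 * (w r \<bullet> x r) + \<eta>)"
    using energy_increment[OF S x w] r st by simp
  with eventually_at_right_less[of "0::real"]
  show "\<forall>\<^sub>F h in at_right 0. (norm (x (r + h)))\<^sup>2 \<le> (norm (x r))\<^sup>2 + h * (k + \<eta>)"
  proof eventually_elim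
    case (elim h)
    have "h * (2 * (w r \<bullet> x r) + \<eta>) \<le> h * (k + \<eta>)"
      using elim k[of r] r by (intro mult_left_mono) auto
    then show ?case using elim by linarith
  qed
qed

section \<open>Existence for Lipschitz and for dissipative nonlinearities\<close>

lemma convolution_exp_bound:
  fixes S :: "real \<Rightarrow> 'a::banach \<Rightarrow> 'a"
  assumes S: "contraction_semigroup S" and w: "continuous_on {0..} w" and k: "0 < k"
    and bound: "\<And>s. 0 \<le> s \<Longrightarrow> norm (w s) \<le> C * exp (k * s)" and t: "0 \<le> t"
  shows "norm (integral {0..t} (\<lambda>s. S (t - s) (w s))) \<le> C / k * exp (k * t)"
proof -
  have "0 \<le> C" using order_trans[OF norm_ge_zero bound[of 0]] by simp
  have hi: "((\<lambda>s. C * exp (k * s)) has_integral C / k * exp (k * t) - C / k * exp (k * 0)) {0..t}"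
    using k by (intro fundamental_theorem_of_calculus t)
      (auto simp: has_real_derivative_iff_has_vector_derivative[symmetric]
        intro!: derivative_eq_intros)
  have "norm (integral {0..t} (\<lambda>s. S (t - s) (w s))) \<le> integral {0..t} (\<lambda>s. C * exp (k * s))"
  proof (rule integral_norm_bound_integral)
    show "(\<lambda>s. S (t - s) (w s)) integrable_on {0..t}"
      by (intro integrable_continuous_interval continuous_on_semigroup[OF S]
          continuous_on_subset[OF w] continuous_intros) auto
    show "(\<lambda>s. C * exp (k * s)) integrable_on {0..t}" using hi by blast
    show "norm (S (t - s) (w s)) \<le> C * exp (k * s)" if "s \<in> {0..t}" for s
      using contraction_semigroupD(5)[OF S, of "t - s" "w s"] bound[of s] that by simp
  qed
  then have "norm (integral {0..t} (\<lambda>s. S (t - s) (w s))) \<le> C / k * exp (k * t) - C / k"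
    unfolding integral_unique[OF hi] by simp
  moreover have "0 \<le> C / k" using \<open>0 \<le> C\<close> k by simp
  ultimately show ?thesis by linarith
qed

lemma forced_orbit_cong:
  assumes "\<And>t. 0 \<le> t \<Longrightarrow> x t = y t"
  shows "forced_orbit S w x0 x \<longleftrightarrow> forced_orbit S w x0 y"
  using assms continuous_on_cong[of "{0..}" "{0..}" x y] by (simp add: forced_orbit_def)

text \<open>Banach's fixed point theorem for the Duhamel map. Multiplied by a decaying exponential, orbits
  become bounded functions and the Duhamel map becomes a contraction on the whole half line at once,
  so that no continuation argument is needed; \<open>g 0 = 0\<close> ensures boundedness.\<close>

lemma Lipschitz_forced_orbit_exists:
  fixes S :: "real \<Rightarrow> 'a::banach \<Rightarrow> 'a"
  assumes S: "contraction_semigroup S" and lip: "L-lipschitz_on UNIV g" and g0: "g 0 = 0"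
  shows "\<exists>x. forced_orbit S (\<lambda>t. g (x t)) x0 x"
proof -
  \<comment> \<open>A positive Lipschitz constant; the decay rate \<open>2 M\<close> below gives the contraction factor 1/2.\<close>
  define M where "M = L + 1"
  have M: "0 < M" "M-lipschitz_on UNIV g"
    using lip lipschitz_on_nonneg[OF lip] by (auto simp: M_def intro: lipschitz_on_le)
  define k where "k = 2 * M"
  have k: "0 < k" using M by (simp add: k_def)
  have gc: "continuous_on T g" for T
    using lipschitz_on_continuous_on[OF M(2)] continuous_on_subset by blast
  \<comment> \<open>For an orbit \<open>exp (k s) y s\<close>, \<open>W y\<close> is its forcing term, \<open>V y\<close> the convolution in the Duhamel
      formula, and \<open>P y\<close> the rescaled Duhamel map, extended by a constant to negative times.\<close>
  define W where "W y s = g (exp (k * s) *\<^sub>R apply_bcontfun y s)" for y s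
  have Wc: "continuous_on {0..} (W y)" for y
    unfolding W_def by (intro continuous_on_compose2[OF gc[of UNIV]] continuous_intros) auto
  define V where "V y t = integral {0..t} (\<lambda>s. S (t - s) (W y s))" for y t
  have Vc: "continuous_on {0..} (V y)" for y
    unfolding V_def by (rule continuous_on_convolution[OF S Wc])
  have Vdiff: "norm (V y t - V z t) \<le> dist y z / 2 * exp (k * t)" if t: "0 \<le> t" for y z t
  proof -
    have int: "(\<lambda>s. S (t - s) (W y s)) integrable_on {0..t}" for y
      by (intro integrable_continuous_interval continuous_on_semigroup[OF S]
          continuous_on_subset[OF Wc] continuous_intros) auto
    have "V y t - V z t = integral {0..t} (\<lambda>s. S (t - s) (W y s) - S (t - s) (W z s))"
      unfolding V_def by (rule integral_diff[symmetric]) (rule int)+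
    also have "\<dots> = integral {0..t} (\<lambda>s. S (t - s) (W y s - W z s))"
      by (rule integral_cong) (simp add: contraction_semigroup_diff[OF S])
    finally have eq: "V y t - V z t = integral {0..t} (\<lambda>s. S (t - s) (W y s - W z s))" .
    have "norm (W y s - W z s) \<le> (M * dist y z) * exp (k * s)" for s
    proof -
      have "norm (W y s - W z s) \<le> M * norm (exp (k * s) *\<^sub>R y s - exp (k * s) *\<^sub>R z s)"
        unfolding W_def by (rule lipschitz_on_normD[OF M(2)]) auto
      also have "\<dots> = M * (exp (k * s) * dist (y s) (z s))"
        by (simp add: dist_norm flip: scaleR_diff_right)
      also have "\<dots> \<le> M * (exp (k * s) * dist y z)"
        using M by (intro mult_left_mono dist_bounded) auto
      finally show ?thesis by (simp add: mult_ac)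
    qed
    then have "norm (V y t - V z t) \<le> (M * dist y z) / k * exp (k * t)"
      unfolding eq by (intro convolution_exp_bound[OF S _ k _ t] continuous_intros Wc)
    also have "(M * dist y z) / k = dist y z / 2" using M by (simp add: k_def)
    finally show ?thesis .
  qed
  have V0: "V 0 t = 0" if "0 \<le> t" for t
  proof -
    have "integral {0..t} (\<lambda>s. S (t - s) (W 0 s)) = integral {0..t} (\<lambda>s. 0)"
      using contraction_semigroupD(1)[OF S]
      by (intro integral_cong) (simp add: W_def g0 linear_0 bounded_linear.linear)
    then show ?thesis by (simp add: V_def)
  qed
  define P where "P y t = exp (- k * max 0 t) *\<^sub>R (S (max 0 t) x0 + V y (max 0 t))" for y t
  have P_in: "P y \<in> bcontfun" for y
  proof (rule bcontfun_normI)
    show "continuous_on UNIV (P y)"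
      unfolding P_def
      by (intro continuous_intros continuous_on_semigroup[OF S] continuous_on_compose2[OF Vc]) auto
    fix t :: real
    let ?t = "max 0 t"
    have "norm (P y t) \<le> exp (- k * ?t) * (norm (S ?t x0) + norm (V y ?t))"
      unfolding P_def by (simp add: norm_triangle_ineq)
    also have "\<dots> \<le> exp (- k * ?t) * (norm x0 + dist y 0 / 2 * exp (k * ?t))"
      using contraction_semigroupD(5)[OF S, of ?t x0] Vdiff[of ?t y 0] V0[of ?t]
      by (intro mult_left_mono add_mono) auto
    also have "\<dots> = exp (- k * ?t) * norm x0 + dist y 0 / 2"
      by (simp add: distrib_left exp_minus)
    also have "\<dots> \<le> norm x0 + dist y 0 / 2"
      using k by (simp add: mult_left_le_one_le)
    finally show "norm (P y t) \<le> norm x0 + dist y 0 / 2" .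
  qed
  have "\<exists>!y. Bcontfun (P y) = y"
  proof (rule banach_fix_type[where c = "1 / 2"])
    show "\<forall>y z. dist (Bcontfun (P y)) (Bcontfun (P z)) \<le> 1 / 2 * dist y z"
    proof (rule allI)+
      fix y z :: "real \<Rightarrow>\<^sub>C 'a"
      show "dist (Bcontfun (P y)) (Bcontfun (P z)) \<le> 1 / 2 * dist y z"
      proof (rule dist_bound)
        fix t :: real
        let ?t = "max 0 t"
        have "dist (P y t) (P z t) = exp (- k * ?t) * norm (V y ?t - V z ?t)"
          unfolding P_def by (simp add: dist_norm flip: scaleR_diff_right)
        also have "\<dots> \<le> exp (- k * ?t) * (dist y z / 2 * exp (k * ?t))"
          by (intro mult_left_mono Vdiff) auto
        also have "\<dots> = 1 / 2 * dist y z" by (simp add: exp_minus)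
        finally show "dist (Bcontfun (P y) t) (Bcontfun (P z) t) \<le> 1 / 2 * dist y z"
          by (simp add: Bcontfun_inverse P_in)
      qed
    qed
  qed auto
  then obtain y where y: "Bcontfun (P y) = y" by blast
  define x where "x t = exp (k * t) *\<^sub>R y t" for t
  have "x t = S t x0 + V y t" if t: "0 \<le> t" for t
  proof -
    have "y t = P y t" by (metis y Bcontfun_inverse P_in)
    then show ?thesis using t by (simp add: x_def P_def exp_minus)
  qed
  moreover have "forced_orbit S (W y) x0 (\<lambda>t. S t x0 + V y t)"
    unfolding V_def by (rule forced_orbit_convolution[OF S Wc])
  ultimately have "forced_orbit S (W y) x0 x" by (simp cong: forced_orbit_cong)
  moreover have "W y = (\<lambda>t. g (x t))" by (simp add: W_def x_def fun_eq_iff)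
  ultimately show ?thesis by auto
qed

definition dissipative :: "('a::real_inner \<Rightarrow> 'a) \<Rightarrow> bool" where
  "dissipative f \<longleftrightarrow> (\<forall>x y. (f x - f y) \<bullet> (x - y) \<le> 0)"

lemma forced_orbit_continuous_on:
  "forced_orbit S w x0 x \<Longrightarrow> T \<subseteq> {0..} \<Longrightarrow> continuous_on T x"
  unfolding forced_orbit_def by (auto intro: continuous_on_subset)

lemma dissipative_orbit_norm_antimono:
  fixes S :: "real \<Rightarrow> 'a::{real_inner, banach} \<Rightarrow> 'a"
  assumes S: "contraction_semigroup S" and f: "continuous_on UNIV f" "dissipative f" "f 0 = 0"
    and x: "forced_orbit S (\<lambda>t. f (x t)) x0 x" and st: "0 \<le> s" "s \<le> t"
  shows "norm (x t) \<le> norm (x s)"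
proof -
  have "f y \<bullet> y \<le> 0" for y
    using f(2,3) unfolding dissipative_def by (metis diff_zero)
  then have "(norm (x t))\<^sup>2 \<le> (norm (x s))\<^sup>2 + 0 * (t - s)"
    by (intro energy_bound[OF S x _ st] continuous_on_compose2[OF f(1)]
        forced_orbit_continuous_on[OF x]) auto
  then show ?thesis by (simp add: power2_le_iff_abs_le)
qed

lemma dissipative_orbit_unique:
  fixes S :: "real \<Rightarrow> 'a::{real_inner, banach} \<Rightarrow> 'a"
  assumes S: "contraction_semigroup S" and f: "continuous_on UNIV f" "dissipative f"
    and x: "forced_orbit S (\<lambda>t. f (x t)) x0 x" and y: "forced_orbit S (\<lambda>t. f (y t)) x0 y"
    and t: "0 \<le> t"
  shows "x t = y t"
proof -
  have "(norm (x t - y t))\<^sup>2 \<le> (norm (x 0 - y 0))\<^sup>2 + 0 * (t - 0)"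
    using f(2) unfolding dissipative_def
    by (intro energy_bound[OF S forced_orbit_diff[OF S x y] _ _ t] continuous_intros
        continuous_on_compose2[OF f(1)] forced_orbit_continuous_on[OF x]
        forced_orbit_continuous_on[OF y]) auto
  then show ?thesis using forced_orbit_0[OF S x] forced_orbit_0[OF S y] by simp
qed

lemma continuous_on_half_lineI:
  fixes x :: "real \<Rightarrow> 'a::topological_space"
  assumes "\<And>b. continuous_on {0..b} x"
  shows "continuous_on {0..} x"
  unfolding continuous_on_eq_continuous_within
proof
  fix t :: real assume t: "t \<in> {0..}"
  have "at t within {0..} = at t within {0..t + 1}"
    by (rule at_within_nhd[of _ "{t - 1<..<t + 1}"]) auto
  moreover have "continuous (at t within {0..t + 1}) x"
    using assms[of "t + 1"] t by (simp add: continuous_on_eq_continuous_within)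
  ultimately show "continuous (at t within {0..}) x" by (simp add: continuous_within)
qed

text \<open>The Lipschitz constants of the approximations may blow up, so Gronwall's inequality would not
  help. Dissipativity makes the squared distance of two approximating orbits grow at a rate controlled
  by the distance of the nonlinearities alone; hence the orbits form a locally uniform Cauchy
  sequence.\<close>

lemma dissipative_limit_orbit_exists:
  fixes S :: "real \<Rightarrow> 'a::{real_inner, banach} \<Rightarrow> 'a" and F :: "nat \<Rightarrow> 'a \<Rightarrow> 'a"
  assumes S: "contraction_semigroup S"
    and lip: "\<And>n. \<exists>L. L-lipschitz_on UNIV (F n)"
    and F0: "\<And>n. F n 0 = 0"
    and diss: "\<And>n. dissipative (F n)"
    and approx: "\<And>n x. norm (F n x - f x) \<le> \<rho> n" and \<rho>: "\<rho> \<longlonglongrightarrow> 0"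
  shows "\<exists>x. forced_orbit S (\<lambda>t. f (x t)) x0 x"
proof -
  have "\<exists>x. forced_orbit S (\<lambda>t. F n (x t)) x0 x" for n
    using lip[of n] Lipschitz_forced_orbit_exists[OF S, where g = "F n"] F0 by blast
  then obtain X where X: "\<And>n. forced_orbit S (\<lambda>t. F n (X n t)) x0 (X n)" by metis
  have Fuc: "uniformly_continuous_on UNIV (F n)" for n
    using lip[of n] lipschitz_on_uniformly_continuous by blast
  have Fc: "continuous_on T (F n)" for n T
    using uniformly_continuous_imp_continuous[OF Fuc[of n]] continuous_on_subset by blast
  have Xc: "continuous_on T (X n)" if "T \<subseteq> {0..}" for n T
    using forced_orbit_continuous_on[OF X that] .
  have FXc: "continuous_on T (\<lambda>t. F n (X n t))" if "T \<subseteq> {0..}" for n T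
    by (rule continuous_on_compose2[OF Fc Xc[OF that]]) auto
  have fuc: "uniformly_continuous_on UNIV f"
    unfolding uniformly_continuous_on_def
  proof (intro allI impI)
    fix e :: real assume e: "0 < e"
    then obtain n where n: "\<rho> n < e / 3"
      using order_tendstoD(2)[OF \<rho>, of "e / 3"] eventually_sequentially by auto
    from e obtain d where d: "0 < d" "\<And>x y. dist y x < d \<Longrightarrow> dist (F n y) (F n x) < e / 3"
      using Fuc[of n] unfolding uniformly_continuous_on_def by (metis UNIV_I zero_less_divide_iff zero_less_numeral)
    have "dist (f y) (f x) < e" if "dist y x < d" for x y
    proof -
      have "f y - f x = (F n y - F n x) - (F n y - f y) + (F n x - f x)" by simp
      then have "norm (f y - f x) \<le> norm (F n y - F n x) + norm (F n y - f y) + norm (F n x - f x)"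
        by (metis norm_triangle_ineq4 norm_triangle_le order_refl add_right_mono norm_triangle_mono)
      then show ?thesis
        using d(2)[OF that] approx[of n y] approx[of n x] n by (simp add: dist_norm)
    qed
    with d(1) show "\<exists>d>0. \<forall>x\<in>UNIV. \<forall>x'\<in>UNIV. dist x' x < d \<longrightarrow> dist (f x') (f x) < e" by blast
  qed
  have bound: "norm (X n t) \<le> norm x0" if "0 \<le> t" for n t
    using dissipative_orbit_norm_antimono[OF S Fc diss F0 X order_refl that, of n]
      forced_orbit_0[OF S X[of n]] by simp
  have dist: "(norm (X n t - X m t))\<^sup>2 \<le> 4 * norm x0 * b * (\<rho> n + \<rho> m)"
    if t: "0 \<le> t" "t \<le> b" for n m t b
  proof -
    have \<rho>0: "0 \<le> \<rho> n + \<rho> m"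
      using order_trans[OF norm_ge_zero approx[of n 0]] order_trans[OF norm_ge_zero approx[of m 0]] by simp
    have "2 * ((F n (X n r) - F m (X m r)) \<bullet> (X n r - X m r)) \<le> 4 * norm x0 * (\<rho> n + \<rho> m)"
      if r: "0 \<le> r" "r \<le> t" for r
    proof -
      let ?d = "X n r - X m r" and ?e = "F n (X n r) - F m (X n r)"
      have "(F n (X n r) - F m (X m r)) \<bullet> ?d = ?e \<bullet> ?d + (F m (X n r) - F m (X m r)) \<bullet> ?d"
        by (simp add: inner_diff_left)
      also have "\<dots> \<le> ?e \<bullet> ?d"
        using diss[of m] unfolding dissipative_def by (simp add: add_increasing2)
      also have "\<dots> \<le> norm ?e * norm ?d" by (rule norm_cauchy_schwarz)
      also have "\<dots> \<le> (\<rho> n + \<rho> m) * (2 * norm x0)"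
      proof (intro mult_mono \<rho>0 norm_ge_zero)
        have "?e = (F n (X n r) - f (X n r)) - (F m (X n r) - f (X n r))" by simp
        then have "norm ?e \<le> norm (F n (X n r) - f (X n r)) + norm (F m (X n r) - f (X n r))"
          by (metis norm_triangle_ineq4)
        then show "norm ?e \<le> \<rho> n + \<rho> m"
          using approx[of n "X n r"] approx[of m "X n r"] by linarith
        show "norm ?d \<le> 2 * norm x0"
          using norm_triangle_ineq4[of "X n r" "X m r"] bound[OF r(1), of n] bound[OF r(1), of m]
          by linarith
      qed
      finally show ?thesis by (simp add: algebra_simps)
    qed
    then have "(norm (X n t - X m t))\<^sup>2 \<le>
        (norm (X n 0 - X m 0))\<^sup>2 + 4 * norm x0 * (\<rho> n + \<rho> m) * (t - 0)"
      by (intro energy_bound[OF S forced_orbit_diff[OF S X X] _ _ t(1)] continuous_intros FXc) auto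
    also have "\<dots> = 4 * norm x0 * (\<rho> n + \<rho> m) * t"
      using forced_orbit_0[OF S X[of n]] forced_orbit_0[OF S X[of m]] by simp
    also have "\<dots> \<le> 4 * norm x0 * (\<rho> n + \<rho> m) * b"
      using t \<rho>0 by (intro mult_left_mono) auto
    finally show ?thesis by (simp add: mult_ac)
  qed
  define x where "x t = lim (\<lambda>n. X n t)" for t
  have Xx: "uniform_limit {0..b} X x sequentially" for b
  proof -
    have "uniformly_Cauchy_on {0..b} X"
    proof (rule uniformly_Cauchy_onI')
      fix e :: real assume e: "0 < e"
      have "(\<lambda>n. 4 * norm x0 * b * \<rho> n) \<longlonglongrightarrow> 4 * norm x0 * b * 0"
        by (intro tendsto_intros \<rho>)
      then have "\<forall>\<^sub>F n in sequentially. 4 * norm x0 * b * \<rho> n < e\<^sup>2 / 2"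
        by (rule order_tendstoD(2)) (use e in simp)
      then obtain N where N: "\<And>n. n \<ge> N \<Longrightarrow> 4 * norm x0 * b * \<rho> n < e\<^sup>2 / 2"
        unfolding eventually_sequentially by blast
      have "dist (X m t) (X n t) < e" if "t \<in> {0..b}" "N \<le> m" "m < n" for t m n
      proof -
        have "(norm (X m t - X n t))\<^sup>2 < e\<^sup>2"
          using dist[of t b m n] N[of m] N[of n] that by (simp add: distrib_left)
        then show ?thesis using e by (simp add: dist_norm power2_less_imp_less)
      qed
      then show "\<exists>N. \<forall>t\<in>{0..b}. \<forall>m\<ge>N. \<forall>n>m. dist (X m t) (X n t) < e" by blast
    qed
    then show ?thesis
      unfolding x_def uniformly_convergent_uniform_limit_iff[symmetric]
      by (rule Cauchy_uniformly_convergent)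
  qed
  have "continuous_on {0..b} x" for b
    by (rule uniform_limit_theorem[OF _ Xx]) (auto intro!: always_eventually Xc)
  then have xc: "continuous_on {0..} x" by (rule continuous_on_half_lineI)
  have FX: "uniform_limit {0..b} (\<lambda>n t. F n (X n t)) (\<lambda>t. f (x t)) sequentially" for b
  proof -
    have "uniform_limit {0..b} (\<lambda>n t. F n (X n t) - f (X n t)) (\<lambda>t. 0) sequentially"
    proof (rule uniform_limitI)
      fix e :: real assume "0 < e"
      then have "\<forall>\<^sub>F n in sequentially. \<rho> n < e" by (rule order_tendstoD(2)[OF \<rho>])
      then show "\<forall>\<^sub>F n in sequentially. \<forall>t\<in>{0..b}. dist (F n (X n t) - f (X n t)) 0 < e"
        by eventually_elim (auto intro: le_less_trans[OF approx])
    qed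
    moreover have "uniform_limit {0..b} (\<lambda>n t. f (X n t)) (\<lambda>t. f (x t)) sequentially"
      by (rule uniform_limit_compose_uniformly_continuous_on[OF Xx fuc]) auto
    ultimately show ?thesis using uniform_limit_add by fastforce
  qed
  have "((\<lambda>s. S (t - s) (f (x s))) has_integral (x t - S t x0)) {0..t}" if t: "0 \<le> t" for t
  proof -
    have u: "uniform_limit {0..t} (\<lambda>n s. S (t - s) (F n (X n s))) (\<lambda>s. S (t - s) (f (x s))) sequentially"
    proof (rule uniform_limitI)
      fix e :: real assume "0 < e"
      from uniform_limitD[OF FX this, of t]
      show "\<forall>\<^sub>F n in sequentially. \<forall>s\<in>{0..t}. dist (S (t - s) (F n (X n s))) (S (t - s) (f (x s))) < e"
      proof eventually_elim
        case (elim n)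
        show ?case
        proof
          fix s assume s: "s \<in> {0..t}"
          then have "dist (S (t - s) (F n (X n s))) (S (t - s) (f (x s))) \<le> dist (F n (X n s)) (f (x s))"
            using contraction_semigroupD(5)[OF S, of "t - s" "F n (X n s) - f (x s)"]
            by (simp add: dist_norm contraction_semigroup_diff[OF S])
          also have "\<dots> < e" using elim s by blast
          finally show "dist (S (t - s) (F n (X n s))) (S (t - s) (f (x s))) < e" .
        qed
      qed
    qed
    have c: "continuous_on {0..t} (\<lambda>s. S (t - s) (F n (X n s)))" for n
      by (intro continuous_on_semigroup[OF S] FXc continuous_intros) auto
    obtain I J where I: "\<And>n. ((\<lambda>s. S (t - s) (F n (X n s))) has_integral I n) {0..t}"
      and J: "((\<lambda>s. S (t - s) (f (x s))) has_integral J) {0..t}" and lim: "I \<longlonglongrightarrow> J"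
      by (rule uniform_limit_integral_cbox[OF u[folded cbox_interval] c[folded cbox_interval]
            trivial_limit_sequentially, unfolded cbox_interval]) (rule that)
    have "I n = X n t - S t x0" for n
      using X[of n] t I[of n] has_integral_unique unfolding forced_orbit_def by blast
    moreover have "(\<lambda>n. X n t - S t x0) \<longlonglongrightarrow> x t - S t x0"
      by (intro tendsto_intros tendsto_uniform_limitI[OF Xx[of t]]) (use t in auto)
    ultimately have "J = x t - S t x0" using lim LIMSEQ_unique by (metis (no_types, lifting) ext)
    with J show ?thesis by simp
  qed
  with xc show ?thesis unfolding forced_orbit_def by blast
qed

section \<open>Finite-time extinction and invariant subspaces\<close>

text \<open>The graph of the concave function \<open>a \<mapsto> a powr p\<close> lies below its tangent at \<open>b\<close>.\<close>

lemma powr_tangent_bound: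
  fixes a b p :: real
  assumes "0 \<le> a" "0 < b" "0 < p" "p < 1"
  shows "a powr p \<le> b powr (p - 1) * (p * a + (1 - p) * b)"
proof (cases "a = 0")
  case True
  then show ?thesis using assms by simp
next
  case False
  have "a powr p = b powr (p - 1) * (a powr p * b powr (1 - p))"
    using assms by (simp add: mult.left_commute flip: powr_add)
  also have "\<dots> \<le> b powr (p - 1) * (p * a + (1 - p) * b)"
    using assms False by (intro mult_left_mono Youngs_inequality_0) auto
  finally show ?thesis .
qed

text \<open>The assumption on \<open>w\<close> makes the upper right Dini derivative of \<open>((norm x)\<^sup>2) powr \<mu>\<close> at most
  \<open>- 2 c \<mu>\<close> as long as \<open>x\<close> does not vanish. So this quantity cannot stay positive up to time \<open>T\<close>.\<close>

lemma finite_time_extinction: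
  fixes S :: "real \<Rightarrow> 'a::{real_inner, banach} \<Rightarrow> 'a"
  assumes S: "contraction_semigroup S" and x: "forced_orbit S w x0 x"
    and w: "continuous_on {0..} w" and c: "0 < c" and \<mu>: "0 < \<mu>" "\<mu> < 1"
    and diss: "\<And>t. 0 \<le> t \<Longrightarrow> w t \<bullet> x t \<le> - c * ((norm (x t))\<^sup>2) powr (1 - \<mu>)"
    and T: "((norm x0)\<^sup>2) powr \<mu> \<le> 2 * c * \<mu> * T" "0 \<le> T"
  shows "\<exists>t\<in>{0..T}. x t = 0"
proof (rule ccontr)
  assume "\<not> ?thesis"
  then have nz: "x t \<noteq> 0" if "0 \<le> t" "t \<le> T" for t using that by auto
  define E where "E t = (norm (x t))\<^sup>2" for t
  have E: "0 < E t" if "0 \<le> t" "t \<le> T" for t using nz[OF that] by (simp add: E_def)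
  have "E T powr \<mu> \<le> E 0 powr \<mu> + (- 2 * c * \<mu>) * (T - 0)"
  proof (rule right_Dini_bound[OF T(2)])
    have "continuous_on {0..T} x" by (rule forced_orbit_continuous_on[OF x]) auto
    then show "continuous_on {0..T} (\<lambda>t. E t powr \<mu>)"
      using nz unfolding E_def by (intro continuous_intros) auto
    fix t \<eta> :: real assume t: "0 \<le> t" "t < T" and \<eta>: "0 < \<eta>"
    have Et: "0 < E t" using E t by simp
    \<comment> \<open>The slack in the energy inequality that the chain rule turns into a slack of exactly \<open>\<eta>\<close>.\<close>
    define \<delta> where "\<delta> = \<eta> * E t powr (1 - \<mu>) / \<mu>"
    have "0 < \<delta>" using \<eta> \<mu> Et by (simp add: \<delta>_def)
    from energy_increment[OF S x w t(1) this] eventually_at_right_less[of "0::real"]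
    show "\<forall>\<^sub>F h in at_right 0. E (t + h) powr \<mu> \<le> E t powr \<mu> + h * (- 2 * c * \<mu> + \<eta>)"
    proof eventually_elim
      case (elim h)
      have "E (t + h) \<le> E t + h * (2 * (w t \<bullet> x t) + \<delta>)"
        using elim by (simp add: E_def)
      also have "\<dots> \<le> E t + h * (- 2 * c * E t powr (1 - \<mu>) + \<delta>)"
        using elim diss[OF t(1)] by (intro add_left_mono mult_left_mono) (auto simp: E_def)
      finally have le: "E (t + h) \<le> E t + h * (- 2 * c * E t powr (1 - \<mu>) + \<delta>)" .
      have "E (t + h) powr \<mu> \<le> E t powr (\<mu> - 1) * (\<mu> * E (t + h) + (1 - \<mu>) * E t)"
        by (rule powr_tangent_bound[OF _ Et \<mu>]) (simp add: E_def)
      also have "\<dots> \<le> E t powr (\<mu> - 1) *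
          (\<mu> * (E t + h * (- 2 * c * E t powr (1 - \<mu>) + \<delta>)) + (1 - \<mu>) * E t)"
        using \<mu> le by (intro mult_left_mono add_right_mono) auto
      also have "\<dots> = E t powr (\<mu> - 1) * E t
          + h * (E t powr (\<mu> - 1) * E t powr (1 - \<mu>)) * (- 2 * c * \<mu> + \<eta>)"
        using \<mu> by (simp add: \<delta>_def algebra_simps)
      also have "E t powr (\<mu> - 1) * E t powr (1 - \<mu>) = 1"
        using Et by (simp flip: powr_add)
      also have "E t powr (\<mu> - 1) * E t = E t powr \<mu>"
        using Et powr_mult_base[of "E t" "\<mu> - 1"] by (simp add: mult.commute)
      finally show ?case by simp
    qed
  qed
  also have "\<dots> \<le> 0" using T forced_orbit_0[OF S x] by (simp add: E_def mult_ac)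
  finally show False using E[OF T(2) order_refl] by simp
qed

text \<open>Testing the Duhamel formula against an element of \<open>U\<close> annihilates every term but the state.\<close>

lemma forced_orbit_in_orthogonal_comp:
  fixes S :: "real \<Rightarrow> 'a::{real_inner, banach} \<Rightarrow> 'a"
  assumes inv: "invariant_under S (U\<^sup>\<bottom>)"
    and x: "forced_orbit S w x0 x" and x0: "x0 \<in> U\<^sup>\<bottom>" and w: "\<And>t. 0 \<le> t \<Longrightarrow> w t \<in> U\<^sup>\<bottom>"
    and t: "0 \<le> t"
  shows "x t \<in> U\<^sup>\<bottom>"
proof -
  have S: "k \<bullet> S r v = 0" if "k \<in> U" "0 \<le> r" "v \<in> U\<^sup>\<bottom>" for k r v
    using inv that unfolding invariant_under_def orthogonal_comp_def orthogonal_def by blast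
  have "k \<bullet> x t = 0" if k: "k \<in> U" for k
  proof -
    have "((\<lambda>s. S (t - s) (w s)) has_integral (x t - S t x0)) {0..t}"
      using x t unfolding forced_orbit_def by blast
    from has_integral_linear[OF this bounded_linear_inner_right[of k]]
    have "((\<lambda>s. k \<bullet> S (t - s) (w s)) has_integral k \<bullet> (x t - S t x0)) {0..t}"
      by (simp add: o_def)
    moreover have "((\<lambda>s. k \<bullet> S (t - s) (w s)) has_integral 0) {0..t}"
      by (rule has_integral_is_0) (use S[OF k] w in auto)
    ultimately have "k \<bullet> (x t - S t x0) = 0" by (rule has_integral_unique)
    then show ?thesis using S[OF k t x0] by (simp add: inner_diff_right)
  qed
  then show ?thesis by (auto simp: orthogonal_comp_def orthogonal_def)
qed

section \<open>The damping nonlinearity of a positive operator\<close>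

locale positive_operator = bounded_linear B for B :: "'a::real_inner \<Rightarrow> 'a" +
  assumes self_adjoint: "self_adjoint B" and nonneg: "0 \<le> B x \<bullet> x"
begin

definition seminorm :: "'a \<Rightarrow> real" where
  "seminorm x = sqrt (B x \<bullet> x)"

lemma seminorm_nonneg: "0 \<le> seminorm x"
  by (simp add: seminorm_def nonneg)

lemma seminorm_power2: "(seminorm x)\<^sup>2 = B x \<bullet> x"
  by (simp add: seminorm_def nonneg)

lemma B_commute: "B y \<bullet> x = B x \<bullet> y"
  using self_adjoint by (metis inner_commute self_adjoint_def)

text \<open>The usual discriminant argument, with the degenerate case of a vanishing leading coefficient, as
  \<open>B\<close> may have a kernel.\<close>

lemma Cauchy_Schwarz: "B x \<bullet> y \<le> seminorm x * seminorm y"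
proof -
  have q: "0 \<le> B x \<bullet> x + 2 * t * (B x \<bullet> y) + t\<^sup>2 * (B y \<bullet> y)" for t
    using nonneg[of "x + t *\<^sub>R y"] B_commute[of y x]
    by (simp add: add scaleR inner_add_left inner_add_right power2_eq_square algebra_simps)
  have "(B x \<bullet> y)\<^sup>2 \<le> (B x \<bullet> x) * (B y \<bullet> y)"
  proof (cases "B y \<bullet> y = 0")
    case True
    have "B x \<bullet> y = 0"
    proof (rule ccontr)
      assume b: "B x \<bullet> y \<noteq> 0"
      show False
        using q[of "- (B x \<bullet> x + 1) / (2 * (B x \<bullet> y))"] b True by (simp add: field_simps)
    qed
    then show ?thesis by (simp add: True)
  next
    case False
    then have "0 < B y \<bullet> y" using nonneg[of y] by simp
    with q[of "- (B x \<bullet> y) / (B y \<bullet> y)"] show ?thesis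
      by (simp add: field_simps power2_eq_square)
  qed
  then have "B x \<bullet> y \<le> sqrt ((B x \<bullet> x) * (B y \<bullet> y))" by (rule real_le_rsqrt)
  then show ?thesis by (simp add: seminorm_def real_sqrt_mult)
qed

lemma seminorm_le: "seminorm x \<le> sqrt (onorm B) * norm x"
proof -
  have "B x \<bullet> x \<le> norm (B x) * norm x" by (rule norm_cauchy_schwarz)
  also have "\<dots> \<le> onorm B * norm x * norm x"
    by (intro mult_right_mono onorm bounded_linear) auto
  finally have "sqrt (B x \<bullet> x) \<le> sqrt (onorm B * (norm x)\<^sup>2)" 
    by (simp add: power2_eq_square mult.assoc)
  then show ?thesis by (simp add: seminorm_def real_sqrt_mult)
qed

text \<open>The norm of \<open>B x\<close> is bounded by the seminorm of \<open>x\<close>, not merely by its norm. Therefore the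
  product of \<open>B x\<close> with the singular gain of the feedback is at most of order
  \<open>seminorm x powr (1 - 2 * \<mu>)\<close>, which tends to 0 at the kernel.\<close>

lemma norm_B_le: "norm (B x) \<le> sqrt (onorm B) * seminorm x"
proof (cases "B x = 0")
  case True
  then show ?thesis by (simp add: seminorm_nonneg onorm_pos_le bounded_linear)
next
  case False
  have "norm (B x) * norm (B x) = B x \<bullet> B x"
    by (simp flip: power2_norm_eq_inner add: power2_eq_square)
  also have "\<dots> \<le> seminorm x * (sqrt (onorm B) * norm (B x))"
    by (rule order_trans[OF Cauchy_Schwarz]) (intro mult_left_mono seminorm_le seminorm_nonneg)
  finally have "norm (B x) * norm (B x) \<le> (sqrt (onorm B) * seminorm x) * norm (B x)"
    by (simp add: mult_ac)
  then show ?thesis using False by simp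
qed

lemma seminorm_diff: "seminorm x - seminorm y \<le> seminorm (x - y)"
proof (rule power2_le_imp_le[OF _ seminorm_nonneg])
  have "(seminorm x - seminorm y)\<^sup>2 = B x \<bullet> x + B y \<bullet> y - 2 * (seminorm x * seminorm y)"
    by (simp add: power2_diff seminorm_power2)
  also have "\<dots> \<le> B x \<bullet> x + B y \<bullet> y - 2 * (B x \<bullet> y)"
    using Cauchy_Schwarz[of x y] by simp
  also have "\<dots> = (seminorm (x - y))\<^sup>2"
    using B_commute[of y x] by (simp add: seminorm_power2 diff inner_diff_left inner_diff_right)
  finally show "(seminorm x - seminorm y)\<^sup>2 \<le> (seminorm (x - y))\<^sup>2" .
qed

text \<open>The truncation level \<open>\<epsilon>\<close> regularises the gain near the kernel of \<open>B\<close>; the feedback law itself is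
  the case \<open>\<epsilon> = 0\<close>.\<close>

definition gain :: "real \<Rightarrow> real \<Rightarrow> 'a \<Rightarrow> real" where
  "gain \<mu> \<epsilon> x = max (B x \<bullet> x) \<epsilon> powr (- \<mu>)"

definition damping :: "real \<Rightarrow> real \<Rightarrow> 'a \<Rightarrow> 'a" where
  "damping \<mu> \<epsilon> x = - gain \<mu> \<epsilon> x *\<^sub>R B x"

lemma gain_nonneg: "0 \<le> gain \<mu> \<epsilon> x"
  by (simp add: gain_def)

lemma damping_0 [simp]: "damping \<mu> \<epsilon> 0 = 0"
  by (simp add: damping_def zero)

lemma damping_eq_feedback: "damping \<mu> 0 x = feedback B \<mu> x *\<^sub>R B x"
  by (simp add: damping_def gain_def feedback_def zero nonneg max_absorb1)

lemma damping_in_ker_perp: "damping \<mu> \<epsilon> x \<in> ker_perp B"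
proof -
  have "k \<bullet> B x = 0" if "B k = 0" for k
    using B_commute[of x k] that by (simp add: inner_commute)
  then show ?thesis by (auto simp: orthogonal_comp_def orthogonal_def damping_def)
qed

text \<open>In terms of \<open>s = seminorm x\<close>, the product is \<open>s\<close> times a constant below the truncation level and
  \<open>s powr (1 - 2 * \<mu>)\<close> above it; \<open>\<mu> < 1 / 2\<close> enters here. This monotonicity stands in for
  the convexity of the potential.\<close>

lemma gain_seminorm_mono:
  assumes \<mu>: "0 < \<mu>" "\<mu> < 1 / 2" and le: "seminorm y \<le> seminorm x"
  shows "gain \<mu> \<epsilon> y * seminorm y \<le> gain \<mu> \<epsilon> x * seminorm x"
proof -
  have qle: "B y \<bullet> y \<le> B x \<bullet> x"
    using le by (simp add: seminorm_def)
  show ?thesis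
  proof (cases "B x \<bullet> x \<le> \<epsilon>")
    case True
    then have "gain \<mu> \<epsilon> y = gain \<mu> \<epsilon> x" using qle by (simp add: gain_def max_absorb2)
    then show ?thesis using le by (simp add: mult_left_mono gain_nonneg)
  next
    case False
    \<comment> \<open>The truncated energy of \<open>y\<close>; replacing the seminorm of \<open>y\<close> by the square root of \<open>R\<close> treats
        both sides of the truncation level together.\<close>
    define R where "R = max (B y \<bullet> y) \<epsilon>"
    have R: "0 \<le> R" "R \<le> B x \<bullet> x" "B y \<bullet> y \<le> R"
      using False qle nonneg[of y] by (auto simp: R_def)
    have "gain \<mu> \<epsilon> y * seminorm y \<le> R powr (- \<mu>) * R powr (1 / 2)"
      using R nonneg[of y] by (auto simp: gain_def R_def[symmetric] seminorm_def powr_half_sqrt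
          intro!: mult_left_mono)
    also have "\<dots> = R powr (1 / 2 - \<mu>)" by (simp flip: powr_add)
    also have "\<dots> \<le> (B x \<bullet> x) powr (1 / 2 - \<mu>)"
      using R \<mu> by (intro powr_mono2) auto
    also have "\<dots> = (B x \<bullet> x) powr (- \<mu>) * (B x \<bullet> x) powr (1 / 2)" by (simp flip: powr_add)
    also have "\<dots> = gain \<mu> \<epsilon> x * seminorm x"
      using False nonneg[of x] by (simp add: gain_def seminorm_def powr_half_sqrt max_absorb1)
    finally show ?thesis .
  qed
qed

text \<open>With \<open>p\<close>, \<open>r\<close> the seminorms and \<open>a\<close>, \<open>b\<close> the gains of \<open>x\<close>, \<open>y\<close>, Cauchy-Schwarz bounds the inner
  product by \<open>- (p - r) * (a * p - b * r)\<close>, and the two factors have the same sign.\<close>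

lemma dissipative_damping:
  assumes \<mu>: "0 < \<mu>" "\<mu> < 1 / 2"
  shows "dissipative (damping \<mu> \<epsilon>)"
  unfolding dissipative_def
proof (intro allI)
  fix x y
  let ?a = "gain \<mu> \<epsilon> x" and ?b = "gain \<mu> \<epsilon> y" and ?p = "seminorm x" and ?r = "seminorm y"
  have "0 \<le> (?p - ?r) * (?a * ?p - ?b * ?r)"
    using gain_seminorm_mono[OF \<mu>, of x y \<epsilon>] gain_seminorm_mono[OF \<mu>, of y x \<epsilon>]
    by (simp add: zero_le_mult_iff) linarith
  moreover have "(?a + ?b) * (B x \<bullet> y) \<le> (?a + ?b) * (?p * ?r)"
    by (intro mult_left_mono Cauchy_Schwarz add_nonneg_nonneg gain_nonneg)
  moreover have "(damping \<mu> \<epsilon> x - damping \<mu> \<epsilon> y) \<bullet> (x - y)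
      = (?a + ?b) * (B x \<bullet> y) - ?a * ?p\<^sup>2 - ?b * ?r\<^sup>2"
    using B_commute[of y x] unfolding seminorm_power2
    by (simp add: damping_def inner_diff_left inner_diff_right inner_add_left inner_add_right algebra_simps)
  ultimately show "(damping \<mu> \<epsilon> x - damping \<mu> \<epsilon> y) \<bullet> (x - y) \<le> 0"
    by (simp add: power2_eq_square algebra_simps)
qed

text \<open>By symmetry let \<open>y\<close> have the smaller seminorm. Then the change of the gain, multiplied by
  \<open>seminorm y\<close>, is at most \<open>gain x * (seminorm x - seminorm y)\<close> by \<open>gain_seminorm_mono\<close>, so the gain
  never has to be differentiated.\<close>

lemma Lipschitz_damping:
  assumes \<mu>: "0 < \<mu>" "\<mu> < 1 / 2" and \<epsilon>: "0 < \<epsilon>"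
  shows "(2 * onorm B * \<epsilon> powr (- \<mu>))-lipschitz_on UNIV (damping \<mu> \<epsilon>)"
proof -
  have one: "norm (damping \<mu> \<epsilon> x - damping \<mu> \<epsilon> y) \<le> 2 * onorm B * \<epsilon> powr (- \<mu>) * norm (x - y)"
    if le: "seminorm y \<le> seminorm x" for x y
  proof -
    let ?a = "gain \<mu> \<epsilon> x" and ?b = "gain \<mu> \<epsilon> y" and ?K = "sqrt (onorm B)"
    have K: "0 \<le> ?K" "?K * ?K = onorm B" by (simp_all add: onorm_pos_le bounded_linear)
    have a: "?a \<le> \<epsilon> powr (- \<mu>)"
      using \<mu> \<epsilon> by (auto simp: gain_def intro: powr_mono2')
    have "B y \<bullet> y \<le> B x \<bullet> x" using le by (simp add: seminorm_def)
    then have ab: "?a \<le> ?b" using \<mu> \<epsilon> by (auto simp: gain_def intro!: powr_mono2')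
    have "damping \<mu> \<epsilon> x - damping \<mu> \<epsilon> y = (?b - ?a) *\<^sub>R B y - ?a *\<^sub>R B (x - y)"
      by (simp add: damping_def diff algebra_simps)
    then have "norm (damping \<mu> \<epsilon> x - damping \<mu> \<epsilon> y) \<le> (?b - ?a) * norm (B y) + ?a * norm (B (x - y))"
      using norm_triangle_ineq4[of "(?b - ?a) *\<^sub>R B y" "?a *\<^sub>R B (x - y)"] ab
      by (simp add: gain_nonneg)
    also have "\<dots> \<le> (?b - ?a) * (?K * seminorm y) + ?a * (?K * seminorm (x - y))"
      using ab by (intro add_mono mult_left_mono norm_B_le gain_nonneg) auto
    also have "(?b - ?a) * (?K * seminorm y) \<le> ?K * (?a * (seminorm x - seminorm y))"
      using mult_left_mono[OF gain_seminorm_mono[OF \<mu> le, of \<epsilon>] K(1)] by (simp add: algebra_simps)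
    also have "\<dots> \<le> ?K * (?a * seminorm (x - y))"
      by (intro mult_left_mono seminorm_diff gain_nonneg K)
    also have "?K * (?a * seminorm (x - y)) + ?a * (?K * seminorm (x - y))
        = 2 * ?K * ?a * seminorm (x - y)" by simp
    also have "\<dots> \<le> 2 * ?K * \<epsilon> powr (- \<mu>) * (?K * norm (x - y))"
      using a K by (intro mult_mono seminorm_le) (auto simp: seminorm_nonneg gain_nonneg)
    also have "\<dots> = 2 * (?K * ?K) * \<epsilon> powr (- \<mu>) * norm (x - y)" by (simp only: mult_ac)
    finally show ?thesis unfolding K(2) by simp
  qed
  show ?thesis
  proof (rule lipschitz_onI)
    fix x y
    show "dist (damping \<mu> \<epsilon> x) (damping \<mu> \<epsilon> y) \<le> 2 * onorm B * \<epsilon> powr (- \<mu>) * dist x y"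
      using one[of x y] one[of y x] by (cases "seminorm y \<le> seminorm x") (auto simp: dist_norm norm_minus_commute)
  qed (simp add: onorm_pos_le bounded_linear)
qed

text \<open>The truncation acts only where \<open>B x \<bullet> x < \<epsilon>\<close>, and there the untruncated damping is itself
  small.\<close>

lemma damping_approx:
  assumes \<mu>: "0 < \<mu>" "\<mu> < 1 / 2" and \<epsilon>: "0 < \<epsilon>"
  shows "norm (damping \<mu> \<epsilon> x - damping \<mu> 0 x) \<le> sqrt (onorm B) * \<epsilon> powr (1 / 2 - \<mu>)"
proof (cases "\<epsilon> \<le> B x \<bullet> x \<or> B x \<bullet> x = 0")
  case True
  then have "damping \<mu> \<epsilon> x = damping \<mu> 0 x"
  proof
    assume "B x \<bullet> x = 0"
    then have "B x = 0" using norm_B_le[of x] by (simp add: seminorm_def)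
    then show ?thesis by (simp add: damping_def)
  qed (use \<epsilon> in \<open>simp add: damping_def gain_def max_absorb1\<close>)
  then show ?thesis by (simp add: onorm_pos_le bounded_linear)
next
  case False
  then have q: "0 < B x \<bullet> x" "B x \<bullet> x < \<epsilon>" using nonneg[of x] by auto
  have g: "gain \<mu> \<epsilon> x \<le> gain \<mu> 0 x"
    using q \<mu> by (auto simp: gain_def intro!: powr_mono2')
  have "norm (damping \<mu> \<epsilon> x - damping \<mu> 0 x) = (gain \<mu> 0 x - gain \<mu> \<epsilon> x) * norm (B x)"
    using g by (simp add: damping_def flip: scaleR_diff_left)
  also have "\<dots> \<le> gain \<mu> 0 x * (sqrt (onorm B) * seminorm x)"
    by (intro mult_mono norm_B_le) (auto simp: gain_nonneg)
  also have "\<dots> = sqrt (onorm B) * ((B x \<bullet> x) powr (- \<mu>) * (B x \<bullet> x) powr (1 / 2))"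
    using q by (simp add: gain_def seminorm_def powr_half_sqrt max_absorb1)
  also have "\<dots> = sqrt (onorm B) * (B x \<bullet> x) powr (1 / 2 - \<mu>)" by (simp flip: powr_add)
  also have "\<dots> \<le> sqrt (onorm B) * \<epsilon> powr (1 / 2 - \<mu>)"
    using q \<mu> by (intro mult_left_mono powr_mono2) (auto simp: onorm_pos_le bounded_linear)
  finally show ?thesis .
qed

lemma feedback_approximants:
  assumes \<mu>: "0 < \<mu>" "\<mu> < 1 / 2"
  obtains \<epsilon> \<rho> where "\<And>n::nat. 0 < \<epsilon> n" "\<rho> \<longlonglongrightarrow> 0"
    "\<And>n x. norm (damping \<mu> (\<epsilon> n) x - damping \<mu> 0 x) \<le> \<rho> n"
proof
  let ?\<epsilon> = "\<lambda>n. inverse (real (Suc n))"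
  show "0 < ?\<epsilon> n" for n by simp
  have "(\<lambda>n. ?\<epsilon> n powr (1 / 2 - \<mu>)) \<longlonglongrightarrow> 0"
    using \<mu> by (intro tendsto_zero_powrI[OF LIMSEQ_inverse_real_of_nat tendsto_const]) auto
  then show "(\<lambda>n. sqrt (onorm B) * ?\<epsilon> n powr (1 / 2 - \<mu>)) \<longlonglongrightarrow> 0"
    by (rule tendsto_mult_right_zero)
  show "norm (damping \<mu> (?\<epsilon> n) x - damping \<mu> 0 x) \<le> sqrt (onorm B) * ?\<epsilon> n powr (1 / 2 - \<mu>)" for n x
    by (rule damping_approx[OF \<mu>]) simp
qed

text \<open>The gain is unbounded near the kernel of \<open>B\<close>; continuity there comes from the uniform approximation by
  Lipschitz maps.\<close>

lemma continuous_on_damping: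
  assumes \<mu>: "0 < \<mu>" "\<mu> < 1 / 2"
  shows "continuous_on UNIV (damping \<mu> 0)"
proof -
  obtain \<epsilon> \<rho> where \<epsilon>: "\<And>n::nat. 0 < \<epsilon> n" and \<rho>: "\<rho> \<longlonglongrightarrow> 0"
    and le: "\<And>n x. norm (damping \<mu> (\<epsilon> n) x - damping \<mu> 0 x) \<le> \<rho> n"
    using feedback_approximants[OF \<mu>] by metis
  have "uniform_limit UNIV (\<lambda>n. damping \<mu> (\<epsilon> n)) (damping \<mu> 0) sequentially"
  proof (rule uniform_limitI)
    fix e :: real assume "0 < e"
    then have "\<forall>\<^sub>F n in sequentially. \<rho> n < e" by (rule order_tendstoD(2)[OF \<rho>])
    then show "\<forall>\<^sub>F n in sequentially. \<forall>x\<in>UNIV. dist (damping \<mu> (\<epsilon> n) x) (damping \<mu> 0 x) < e"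
      by eventually_elim (auto simp: dist_norm intro: le_less_trans[OF le])
  qed
  then show ?thesis
    by (rule uniform_limit_theorem[rotated])
      (auto intro!: always_eventually lipschitz_on_continuous_on[OF Lipschitz_damping[OF \<mu> \<epsilon>]])
qed

lemma damping_inner_le:
  assumes \<mu>: "0 < \<mu>" "\<mu> < 1" and \<beta>: "0 < \<beta>" "\<beta> * (norm x)\<^sup>2 \<le> B x \<bullet> x"
  shows "damping \<mu> 0 x \<bullet> x \<le> - (\<beta> powr (1 - \<mu>)) * ((norm x)\<^sup>2) powr (1 - \<mu>)"
proof -
  have "\<beta> powr (1 - \<mu>) * ((norm x)\<^sup>2) powr (1 - \<mu>) = (\<beta> * (norm x)\<^sup>2) powr (1 - \<mu>)"
    using \<beta> by (simp add: powr_mult)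
  also have "\<dots> \<le> (B x \<bullet> x) powr (1 - \<mu>)"
    using \<mu> \<beta> by (intro powr_mono2) auto
  also have "\<dots> = (B x \<bullet> x) powr (- \<mu>) * (B x \<bullet> x)"
    using powr_mult_base[OF nonneg[of x], of "- \<mu>"] by (simp add: mult.commute)
  also have "\<dots> = - (damping \<mu> 0 x \<bullet> x)"
    by (simp add: damping_def gain_def nonneg max_absorb1)
  finally show ?thesis by simp
qed

end

section \<open>The closed-loop system\<close>

lemma mild_solution_iff_forced_orbit:
  "mild_solution S B u 0 x0 x \<longleftrightarrow> forced_orbit S (\<lambda>t. u t (x t) *\<^sub>R B (x t)) x0 x"
  by (simp add: mild_solution_def forced_orbit_def)

lemma mild_solution_cong:
  assumes "\<And>t. t0 \<le> t \<Longrightarrow> x t = y t"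
  shows "mild_solution S B u t0 x0 x \<longleftrightarrow> mild_solution S B u t0 x0 y"
proof -
  have "((\<lambda>s. S (t - s) (u s (x s) *\<^sub>R B (x s))) has_integral i) {t0..t} \<longleftrightarrow>
      ((\<lambda>s. S (t - s) (u s (y s) *\<^sub>R B (y s))) has_integral i) {t0..t}" for t i
    by (rule has_integral_cong) (simp add: assms)
  then show ?thesis
    using assms continuous_on_cong[of "{t0..}" "{t0..}" x y] by (simp add: mild_solution_def)
qed

lemma mild_solution_shift:
  fixes S :: "real \<Rightarrow> 'a::{real_inner, banach} \<Rightarrow> 'a"
  shows "mild_solution S B (switched_feedback B \<mu> \<tau>) \<tau> z x \<longleftrightarrow>
    mild_solution S B (\<lambda>t. feedback B \<mu>) 0 z (\<lambda>s. x (s + \<tau>))"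
proof -
  let ?f = "\<lambda>t s. S (t - s) (switched_feedback B \<mu> \<tau> s (x s) *\<^sub>R B (x s))"
  let ?g = "\<lambda>r s. S (r - s) (feedback B \<mu> (x (s + \<tau>)) *\<^sub>R B (x (s + \<tau>)))"
  have "continuous_on {\<tau>..} x \<longleftrightarrow> continuous_on {0..} (\<lambda>s. x (s + \<tau>))"
  proof
    assume c: "continuous_on {\<tau>..} x"
    show "continuous_on {0..} (\<lambda>s. x (s + \<tau>))"
      by (rule continuous_on_compose2[OF c]) (auto intro!: continuous_intros)
  next
    assume c: "continuous_on {0..} (\<lambda>s. x (s + \<tau>))"
    have "continuous_on {\<tau>..} (\<lambda>s. x ((s - \<tau>) + \<tau>))"
      by (rule continuous_on_compose2[OF c]) (auto intro!: continuous_intros)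
    then show "continuous_on {\<tau>..} x" by simp
  qed
  moreover have "(?f (r + \<tau>) has_integral i) {\<tau>..r + \<tau>} \<longleftrightarrow> (?g r has_integral i) {0..r}" for r i
  proof -
    have "(?f (r + \<tau>) has_integral i) {\<tau>..r + \<tau>} \<longleftrightarrow>
        ((\<lambda>s. ?f (r + \<tau>) (s + \<tau>)) has_integral i) {0..r}"
      using has_integral_affinity_iff[of 1 "?f (r + \<tau>)" \<tau> i \<tau> "r + \<tau>"] by simp
    \<comment> \<open>At the switching time itself the control is still 0; a single point does not affect the integral.\<close>
    also have "\<dots> \<longleftrightarrow> (?g r has_integral i) {0..r}"
      by (rule has_integral_spike_finite_eq[of "{0}"]) (auto simp: switched_feedback_def)
    finally show ?thesis .
  qed
  moreover have "(\<forall>t\<ge>\<tau>. P t) \<longleftrightarrow> (\<forall>r\<ge>0. P (r + \<tau>))" for P :: "real \<Rightarrow> bool"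
    by (metis add_le_cancel_right add_0 diff_add_cancel diff_ge_0_iff_ge)
  ultimately show ?thesis unfolding mild_solution_def by simp
qed

text \<open>Up to time \<open>\<tau>\<close> the state is moved by a contraction, and from then on the trajectory is a shifted
  closed-loop trajectory in \<open>F\<close>; so every stability property is inherited.\<close>

lemma switched_finite_time_stable:
  fixes S :: "real \<Rightarrow> 'a::{real_inner, banach} \<Rightarrow> 'a"
  assumes S: "contraction_semigroup S" and \<tau>: "0 < \<tau>" and absorb: "absorbent_in_time \<tau> S F"
    and stable: "finite_time_stable_on F (subspace_trajectory S B (\<lambda>t. feedback B \<mu>) F 0)"
  shows "finite_time_stable_on UNIV (global_trajectory S B (switched_feedback B \<mu> \<tau>) F \<tau>)"
proof -
  let ?traj = "subspace_trajectory S B (\<lambda>t. feedback B \<mu>) F 0"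
  let ?glob = "global_trajectory S B (switched_feedback B \<mu> \<tau>) F \<tau>"
  have F: "S \<tau> x0 \<in> F" for x0 using absorb by (simp add: absorbent_in_time_def)
  have "(\<forall>t\<ge>\<tau>. x t \<in> F) \<longleftrightarrow> (\<forall>r\<ge>0. x (r + \<tau>) \<in> F)" for x
    by (metis add_le_cancel_right add_0 diff_add_cancel diff_ge_0_iff_ge)
  then have glob: "?glob x0 x \<longleftrightarrow>
      (\<forall>t\<in>{0..\<tau>}. x t = S t x0) \<and> ?traj (S \<tau> x0) (\<lambda>s. x (s + \<tau>))" for x0 x
    unfolding global_trajectory_def subspace_trajectory_def mild_solution_shift by simp
  show ?thesis
    unfolding finite_time_stable_on_def
  proof (intro conjI ballI allI impI)
    fix x0 :: 'a
    have "\<exists>y. ?traj (S \<tau> x0) y \<and> (\<forall>z. ?traj (S \<tau> x0) z \<longrightarrow> (\<forall>t\<ge>0. z t = y t))"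
      using stable F[of x0] unfolding finite_time_stable_on_def by blast
    then obtain y where y: "?traj (S \<tau> x0) y"
      and uniq: "\<And>z t. ?traj (S \<tau> x0) z \<Longrightarrow> 0 \<le> t \<Longrightarrow> z t = y t"
      by blast
    have y0: "y 0 = S \<tau> x0"
      using y forced_orbit_0[OF S] unfolding subspace_trajectory_def mild_solution_iff_forced_orbit
      by blast
    define x where "x t = (if t < \<tau> then S t x0 else y (t - \<tau>))" for t
    have "x t = S t x0" if "t \<in> {0..\<tau>}" for t
      using y0 that by (cases "t = \<tau>") (auto simp: x_def)
    moreover have "?traj (S \<tau> x0) (\<lambda>s. x (s + \<tau>))"
    proof -
      have "mild_solution S B (\<lambda>t. feedback B \<mu>) 0 (S \<tau> x0) (\<lambda>s. x (s + \<tau>))"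
        using y mild_solution_cong[of 0 "\<lambda>s. x (s + \<tau>)" y S B]
        unfolding subspace_trajectory_def by (simp add: x_def)
      then show ?thesis using y unfolding subspace_trajectory_def by (simp add: x_def)
    qed
    ultimately have gx: "?glob x0 x" using glob by blast
    show "\<exists>x. ?glob x0 x \<and> (\<forall>z. ?glob x0 z \<longrightarrow> (\<forall>t\<ge>0. z t = x t))"
    proof (intro exI[of _ x] conjI allI impI)
      show "?glob x0 x" by (rule gx)
      fix z t assume z: "?glob x0 z" and t: "0 \<le> (t::real)"
      show "z t = x t"
      proof (cases "t \<le> \<tau>")
        case True
        then show ?thesis using z gx t glob by simp
      next
        case False
        then show ?thesis
          using uniq[of "\<lambda>s. z (s + \<tau>)" "t - \<tau>"] z glob by (simp add: x_def)
      qed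
    qed
  next
    fix \<epsilon> :: real assume \<epsilon>: "0 < \<epsilon>"
    then have "\<exists>\<alpha>>0. \<forall>x0\<in>F. \<forall>x. norm x0 < \<alpha> \<and> ?traj x0 x \<longrightarrow> (\<forall>t\<ge>0. norm (x t) < \<epsilon>)"
      using stable unfolding finite_time_stable_on_def by blast
    then obtain \<alpha> where \<alpha>: "0 < \<alpha>"
      and small: "\<And>x0 x t. x0 \<in> F \<Longrightarrow> norm x0 < \<alpha> \<Longrightarrow> ?traj x0 x \<Longrightarrow> 0 \<le> t \<Longrightarrow> norm (x t) < \<epsilon>"
      by blast
    show "\<exists>\<alpha>>0. \<forall>x0\<in>UNIV. \<forall>x. norm x0 < \<alpha> \<and> ?glob x0 x \<longrightarrow> (\<forall>t\<ge>0. norm (x t) < \<epsilon>)"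
    proof (intro exI[of _ "min \<alpha> \<epsilon>"] conjI ballI allI impI)
      show "0 < min \<alpha> \<epsilon>" using \<alpha> \<epsilon> by simp
      fix x0 x t assume h: "norm x0 < min \<alpha> \<epsilon> \<and> ?glob x0 x" and t: "0 \<le> (t::real)"
      show "norm (x t) < \<epsilon>"
      proof (cases "t \<le> \<tau>")
        case True
        then have "x t = S t x0" using h t glob by simp
        then show ?thesis using contraction_semigroupD(5)[OF S t, of x0] h by simp
      next
        case False
        have "norm (S \<tau> x0) < \<alpha>"
          using contraction_semigroupD(5)[OF S, of \<tau> x0] \<tau> h by simp
        then show ?thesis
          using small[OF F, of x0 "\<lambda>s. x (s + \<tau>)" "t - \<tau>"] h False glob by simp
      qed
    qed
  next
    fix x0 :: 'a
    have "\<exists>T>0. \<forall>y. ?traj (S \<tau> x0) y \<longrightarrow> (\<forall>t\<ge>T. y t = 0)"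
      using stable F[of x0] unfolding finite_time_stable_on_def by blast
    then obtain T where T: "0 < T" "\<And>y t. ?traj (S \<tau> x0) y \<Longrightarrow> T \<le> t \<Longrightarrow> y t = 0"
      by blast
    show "\<exists>T>0. \<forall>x. ?glob x0 x \<longrightarrow> (\<forall>t\<ge>T. x t = 0)"
    proof (intro exI[of _ "T + \<tau>"] conjI allI impI)
      show "0 < T + \<tau>" using T \<tau> by simp
      fix x t assume "?glob x0 x" "T + \<tau> \<le> t"
      then show "x t = 0" using T(2)[of "\<lambda>s. x (s + \<tau>)" "t - \<tau>"] glob by simp
    qed
  qed
qed

theorem theorem9p6:
  fixes S :: "real \<Rightarrow> 'a::{real_inner, banach} \<Rightarrow> 'a"
    and D :: "'a set" and A B :: "'a \<Rightarrow> 'a" and \<beta> \<mu> :: real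
  assumes "contraction_semigroup S" and "generates D A S"
    and "bounded_linear B" and "self_adjoint B" and "\<forall>x. 0 \<le> B x \<bullet> x"
    and "0 < \<beta>" and "\<forall>x\<in>ker_perp B. \<beta> * (norm x)\<^sup>2 \<le> B x \<bullet> x"
    and "invariant_under S (ker_perp B)"
    and "0 < \<mu>" and "\<mu> < 1 / 2"
  shows "finite_time_stable_on (ker_perp B)
           (subspace_trajectory S B (\<lambda>t. feedback B \<mu>) (ker_perp B) 0) \<and>
         (\<forall>\<tau>>0. absorbent_in_time \<tau> S (ker_perp B) \<longrightarrow>
           finite_time_stable_on UNIV
             (global_trajectory S B (switched_feedback B \<mu> \<tau>) (ker_perp B) \<tau>))"
proof -
  interpret positive_operator B
    using assms(3-5) by (simp add: positive_operator_def positive_operator_axioms_def)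
  note S = assms(1) and \<beta> = assms(6,7) and \<mu> = assms(9,10)
  let ?F = "ker_perp B" and ?f = "damping \<mu> 0"
  let ?traj = "subspace_trajectory S B (\<lambda>t. feedback B \<mu>) ?F 0"
  have f: "continuous_on UNIV ?f" "dissipative ?f" "?f 0 = 0"
    using continuous_on_damping[OF \<mu>] dissipative_damping[OF \<mu>] by auto
  have traj: "?traj x0 x \<longleftrightarrow> (\<forall>t\<ge>0. x t \<in> ?F) \<and> forced_orbit S (\<lambda>t. ?f (x t)) x0 x" for x0 x
    by (simp add: subspace_trajectory_def mild_solution_iff_forced_orbit damping_eq_feedback)
  have exists: "\<exists>x. ?traj x0 x" if x0: "x0 \<in> ?F" for x0
  proof -
    obtain \<epsilon> \<rho> where \<epsilon>: "\<And>n::nat. 0 < \<epsilon> n" and \<rho>: "\<rho> \<longlonglongrightarrow> 0"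
      and le: "\<And>n x. norm (damping \<mu> (\<epsilon> n) x - ?f x) \<le> \<rho> n"
      using feedback_approximants[OF \<mu>] by metis
    have "\<exists>x. forced_orbit S (\<lambda>t. ?f (x t)) x0 x"
      by (rule dissipative_limit_orbit_exists[where F = "\<lambda>n. damping \<mu> (\<epsilon> n)", OF S _ _ _ le \<rho>])
        (use Lipschitz_damping[OF \<mu> \<epsilon>] dissipative_damping[OF \<mu>] in auto)
    then obtain x where x: "forced_orbit S (\<lambda>t. ?f (x t)) x0 x" by blast
    have "x t \<in> ?F" if "0 \<le> t" for t
      by (rule forced_orbit_in_orthogonal_comp[OF assms(8) x x0 damping_in_ker_perp that])
    with x show ?thesis using traj by blast
  qed
  have extinct: "x t = 0"
    if x: "?traj x0 x" and t: "((norm x0)\<^sup>2) powr \<mu> / (2 * \<beta> powr (1 - \<mu>) * \<mu>) \<le> t" for x0 x t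
  proof -
    let ?T = "((norm x0)\<^sup>2) powr \<mu> / (2 * \<beta> powr (1 - \<mu>) * \<mu>)"
    have o: "forced_orbit S (\<lambda>t. ?f (x t)) x0 x" and F: "\<And>t. 0 \<le> t \<Longrightarrow> x t \<in> ?F"
      using x traj by auto
    have "\<exists>s\<in>{0..?T}. x s = 0"
    proof (rule finite_time_extinction[OF S o])
      show "continuous_on {0..} (\<lambda>t. ?f (x t))"
        by (rule continuous_on_compose2[OF f(1) forced_orbit_continuous_on[OF o]]) auto
      show "0 < \<beta> powr (1 - \<mu>)" "0 < \<mu>" "\<mu> < 1" "0 \<le> ?T" using \<beta> \<mu> by auto
      show "?f (x t) \<bullet> x t \<le> - (\<beta> powr (1 - \<mu>)) * ((norm (x t))\<^sup>2) powr (1 - \<mu>)" if "0 \<le> t" for t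
        using \<beta> \<mu> F[OF that] by (intro damping_inner_le) auto
      show "((norm x0)\<^sup>2) powr \<mu> \<le> 2 * \<beta> powr (1 - \<mu>) * \<mu> * ?T" using \<beta> \<mu> by simp
    qed
    then obtain s where s: "0 \<le> s" "s \<le> ?T" "x s = 0" by auto
    have "norm (x t) \<le> norm (x s)"
      by (rule dissipative_orbit_norm_antimono[OF S f o]) (use s t in auto)
    then show ?thesis using s by simp
  qed
  have "finite_time_stable_on ?F ?traj"
    unfolding finite_time_stable_on_def
  proof (intro conjI ballI allI impI)
    fix x0 assume "x0 \<in> ?F"
    then obtain x where x: "?traj x0 x" using exists by blast
    have "y t = x t" if "?traj x0 y" "0 \<le> t" for y t
      using dissipative_orbit_unique[OF S f(1,2)] x that traj by blast
    with x show "\<exists>x. ?traj x0 x \<and> (\<forall>y. ?traj x0 y \<longrightarrow> (\<forall>t\<ge>0. y t = x t))" by blast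
  next
    fix \<epsilon> :: real assume \<epsilon>: "0 < \<epsilon>"
    have "norm (x t) < \<epsilon>" if "norm x0 < \<epsilon>" "?traj x0 x" "0 \<le> t" for x0 x t
    proof -
      have o: "forced_orbit S (\<lambda>t. ?f (x t)) x0 x" using that traj by blast
      show ?thesis
        using dissipative_orbit_norm_antimono[OF S f o order_refl that(3)] forced_orbit_0[OF S o] that
        by simp
    qed
    with \<epsilon> show "\<exists>\<alpha>>0. \<forall>x0\<in>?F. \<forall>x. norm x0 < \<alpha> \<and> ?traj x0 x \<longrightarrow> (\<forall>t\<ge>0. norm (x t) < \<epsilon>)"
      by blast
  next
    fix x0 assume "x0 \<in> ?F"
    show "\<exists>T>0. \<forall>x. ?traj x0 x \<longrightarrow> (\<forall>t\<ge>T. x t = 0)"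
      by (rule exI[of _ "((norm x0)\<^sup>2) powr \<mu> / (2 * \<beta> powr (1 - \<mu>) * \<mu>) + 1"])
        (use \<beta> \<mu> extinct in \<open>auto simp: add_nonneg_pos\<close>)
  qed
  then show ?thesis using switched_finite_time_stable[OF S] by blast
qed

end
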